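(* Let $R$ be a unital associative algebra over $\mathbb{K}$. Let $H$ be a subloop of $\mathcal{J}(R)$ such that $[\mathcal{J}(R),H]\subseteq H$ and $I(H)$ is finitely generated either as a left ideal or as a right ideal of $R$. Then $H$ is closed in $\mathcal{J}(R)$.
   Context: $\mathbb{K}$ is a field of characteristic zero; $R$ need not be commutative. $\mathcal{J}(R):=\{t+\sum_{i\ge1}\alpha_it^{i+1}\mid\alpha_i\in R\}\subseteq R[[t]]$ (with $t$ central) is a loop with unit $t$ under substitution $$\Big(\sum_{i\ge0}\alpha_it^{i+1}\Big)\circ\Big(\sum_{j\ge0}\beta_jt^{j+1}\Big):=\sum_{i\ge0}\alpha_i\Big(\sum_{j\ge0}\beta_jt^{j+1}\Big)^{i+1}\qquad(\alpha_0=\beta_0=1).$$ $\mathcal{J}_n(R):=\{t+\sum_{i\ge n}\alpha_it^{i+1}\mid\alpha_i\in R\}$. $\mathcal{J}(R)$ carries the topology in which $\{\mathcal{J}_n(R)\mid n\ge1\}$ is a base of neighborhoods of the unit element $t$. The commutator is $[a,b]:=(b\circ a)\backslash(a\circ b)$, where $x\backslash y$ is the unique $z$ with $x\circ z=y$, and $[\mathcal{J}(R),H]\subseteq H$ means $[a,h]\in H$ for all $a\in\mathcal{J}(R)$, $h\in H$. For $n\ge1$, $\mathfrak{h}_n:=\{\alpha_n\in R\mid t+\alpha_nt^{n+1}\in H\mathcal{J}_{n+1}(R)\}$, where $H\mathcal{J}_{n+1}(R)=\{h\circ u\mid h\in H,\ u\in\mathcal{J}_{n+1}(R)\}$, and $I(H)$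 is the (two-sided) ideal of $R$ generated by $\bigcup_{n\ge1}\mathfrak{h}_n$. *)

theory Defs
  imports
    "HOL-Computational_Algebra.Formal_Power_Series"
    "HOL-Analysis.Abstract_Topology"
    "HOL.Hull"
begin

locale unital_assoc_algebra = vector_space scale
  for scale :: "'k::field \<Rightarrow> 'r::ring_1 \<Rightarrow> 'r" +
  assumes scale_mult_left: "scale c x * y = scale c (x * y)"
    and scale_mult_right: "x * scale c y = scale c (x * y)"

definition left_ideal :: "'r::ring_1 set \<Rightarrow> bool" where
  "left_ideal I \<longleftrightarrow> 0 \<in> I \<and> (\<forall>x\<in>I. \<forall>y\<in>I. x + y \<in> I) \<and> (\<forall>x\<in>I. - x \<in> I) \<and>
     (\<forall>r. \<forall>x\<in>I. r * x \<in> I)"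

definition right_ideal :: "'r::ring_1 set \<Rightarrow> bool" where
  "right_ideal I \<longleftrightarrow> 0 \<in> I \<and> (\<forall>x\<in>I. \<forall>y\<in>I. x + y \<in> I) \<and> (\<forall>x\<in>I. - x \<in> I) \<and>
     (\<forall>r. \<forall>x\<in>I. x * r \<in> I)"

definition two_sided_ideal :: "'r::ring_1 set \<Rightarrow> bool" where
  "two_sided_ideal I \<longleftrightarrow> left_ideal I \<and> right_ideal I"

definition fin_gen_left_ideal :: "'r::ring_1 set \<Rightarrow> bool" where
  "fin_gen_left_ideal I \<longleftrightarrow> (\<exists>F. finite F \<and> I = left_ideal hull F)"

definition fin_gen_right_ideal :: "'r::ring_1 set \<Rightarrow> bool" where
  "fin_gen_right_ideal I \<longleftrightarrow> (\<exists>F. finite F \<and> I = right_ideal hull F)"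

definition is_loop :: "'a set \<Rightarrow> ('a \<Rightarrow> 'a \<Rightarrow> 'a) \<Rightarrow> 'a \<Rightarrow> bool" where
  "is_loop L f e \<longleftrightarrow> e \<in> L \<and> (\<forall>a\<in>L. \<forall>b\<in>L. f a b \<in> L) \<and> (\<forall>a\<in>L. f e a = a \<and> f a e = a) \<and>
     (\<forall>a\<in>L. \<forall>b\<in>L. (\<exists>!x. x \<in> L \<and> f a x = b) \<and> (\<exists>!y. y \<in> L \<and> f y a = b))"

text \<open>A subset of a loop that is itself a loop under the restricted operation; equivalently, it
  contains the unit and is closed under multiplication and both divisions of the ambient loop.\<close>

definition is_subloop :: "'a set \<Rightarrow> 'a set \<Rightarrow> ('a \<Rightarrow> 'a \<Rightarrow> 'a) \<Rightarrow> 'a \<Rightarrow> bool" where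
  "is_subloop H L f e \<longleftrightarrow> H \<subseteq> L \<and> is_loop H f e"

text \<open>The series \<open>t + \<Sum>i\<ge>n. \<alpha>\<^sub>i t\<^sup>i\<^sup>+\<^sup>1\<close>. The coefficient ring need not be commutative;
  \<^const>\<open>fps_compose\<close> puts the coefficients of its first argument on the left, so on
  these sets it is the substitution product \<open>\<Sum>i. \<alpha>\<^sub>i (\<Sum>j. \<beta>\<^sub>j t\<^sup>j\<^sup>+\<^sup>1)\<^sup>i\<^sup>+\<^sup>1\<close>.\<close>

definition Jn :: "nat \<Rightarrow> 'r::ring_1 fps set" where
  "Jn n = {f. fps_nth f 0 = 0 \<and> fps_nth f 1 = 1 \<and> (\<forall>i. 1 \<le> i \<and> i < n \<longrightarrow> fps_nth f (i + 1) = 0)}"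

definition J :: "'r::ring_1 fps set" where
  "J = {f. fps_nth f 0 = 0 \<and> fps_nth f 1 = 1}"

definition J_ldiv :: "'r::ring_1 fps \<Rightarrow> 'r fps \<Rightarrow> 'r fps" where
  "J_ldiv x y = (THE z. z \<in> J \<and> fps_compose x z = y)"

definition J_commutator :: "'r::ring_1 fps \<Rightarrow> 'r fps \<Rightarrow> 'r fps" where
  "J_commutator a b = J_ldiv (fps_compose b a) (fps_compose a b)"

text \<open>Left translations are homeomorphisms of a topological loop, so the base \<open>Jn n\<close>, \<open>n \<ge> 1\<close>, of
  neighbourhoods of the unit determines the topology: the translates \<open>a \<circ> Jn n\<close> form a base of
  neighbourhoods of \<open>a\<close>.\<close>

definition J_topology :: "'r::ring_1 fps topology" where
  "J_topology = topology (\<lambda>U. U \<subseteq> J \<and> (\<forall>a\<in>U. \<exists>n\<ge>1. fps_compose a ` Jn n \<subseteq> U))"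

definition lead_coeffs :: "'r::ring_1 fps set \<Rightarrow> nat \<Rightarrow> 'r set" where
  "lead_coeffs H n = {\<alpha>. fps_X + fps_const \<alpha> * fps_X ^ (n + 1) \<in>
     {fps_compose h u | h u. h \<in> H \<and> u \<in> Jn (n + 1)}}"

definition coeff_ideal :: "'r::ring_1 fps set \<Rightarrow> 'r set" where
  "coeff_ideal H = two_sided_ideal hull (\<Union>n\<in>{1..}. lead_coeffs H n)"

lemma Jn_antimono: "m \<le> n \<Longrightarrow> Jn n \<subseteq> Jn m"
  by (auto simp: Jn_def)

lemma J_eq_Jn_1: "J = Jn 1"
  by (auto simp: Jn_def J_def)

lemma fps_compose_in_J:
  assumes "a \<in> J" "b \<in> J"
  shows "fps_compose a b \<in> J"
  using assms by (simp add: J_def fps_compose_nth)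

lemma openin_J_topology:
  "openin J_topology U \<longleftrightarrow> U \<subseteq> J \<and> (\<forall>a\<in>U. \<exists>n\<ge>1. fps_compose a ` Jn n \<subseteq> U)"
proof -
  let ?P = "\<lambda>U :: 'a fps set. U \<subseteq> J \<and> (\<forall>a\<in>U. \<exists>n\<ge>1. fps_compose a ` Jn n \<subseteq> U)"
  have "?P (S \<inter> T)" if S: "?P S" and T: "?P T" for S T
  proof (intro conjI ballI)
    show "S \<inter> T \<subseteq> J" using S by blast
    fix a assume a: "a \<in> S \<inter> T"
    obtain m where m: "m \<ge> 1" "fps_compose a ` Jn m \<subseteq> S" using S a by blast
    obtain n where n: "n \<ge> 1" "fps_compose a ` Jn n \<subseteq> T" using T a by blast
    have "Jn (max m n) \<subseteq> (Jn m :: 'a fps set)" "Jn (max m n) \<subseteq> (Jn n :: 'a fps set)"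
      by (simp_all add: Jn_antimono)
    then have "fps_compose a ` Jn (max m n) \<subseteq> S \<inter> T" using m n by blast
    then show "\<exists>n\<ge>1. fps_compose a ` Jn n \<subseteq> S \<inter> T" using m(1) by (intro exI[of _ "max m n"]) auto
  qed
  moreover have "?P (\<Union>K)" if K: "\<forall>S\<in>K. ?P S" for K
  proof (intro conjI ballI)
    show "\<Union>K \<subseteq> J" using K by blast
    fix a assume "a \<in> \<Union>K"
    then obtain S where S: "S \<in> K" "a \<in> S" by blast
    then obtain n where "n \<ge> 1" "fps_compose a ` Jn n \<subseteq> S" using K by blast
    then show "\<exists>n\<ge>1. fps_compose a ` Jn n \<subseteq> \<Union>K" using S by blast
  qed
  ultimately have "istopology ?P"
    unfolding istopology_def by blast
  then show ?thesis
    by (simp add: J_topology_def)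
qed

lemma topspace_J_topology [simp]: "topspace J_topology = J"
proof -
  have "openin J_topology J"
    unfolding openin_J_topology J_eq_Jn_1 
    using fps_compose_in_J[unfolded J_eq_Jn_1] by blast
  then show ?thesis
    unfolding topspace_def using openin_J_topology by blast
qed

end

theory Submission
  imports Defs
begin

text \<open>Write \<open>L\<^sub>n\<close> for the set of leading coefficients of order \<open>n\<close> and \<open>I\<close> for the ideal that they
  generate.  The commutator of \<open>t + r t\<^sup>m\<^sup>+\<^sup>1\<close> with \<open>h = t + \<alpha> t\<^sup>n\<^sup>+\<^sup>1 + \<dots>\<close> has leading coefficient
  \<open>(m + 1) r \<alpha> - (n + 1) \<alpha> r\<close> in order \<open>m + n\<close>.  Since \<open>H\<close> is invariant under commutators, this lies
  in \<open>L\<^sub>m\<^sub>+\<^sub>n\<close> whenever \<open>\<alpha> \<in> L\<^sub>n\<close>.  As positive integers are invertible, a central \<open>r\<close> carries \<open>\<alpha>\<close> into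
  all orders above \<open>2 n\<close>, and then two such brackets from adjacent orders yield \<open>r \<alpha>\<close> and \<open>\<alpha> r\<close>
  separately.  Hence each element of \<open>I\<close> is a leading coefficient in all large orders, and if \<open>I\<close> is
  finitely generated on one side, \<open>L\<^sub>n = I\<close> for all \<open>n\<close> from some \<open>N\<close> on
  (\<open>coeff_ideal_subset_lead_coeffs\<close>).

  Let \<open>f\<close> be a limit of \<open>H\<close>.  After division by an element of \<open>H\<close> that is close to \<open>f\<close>, one may
  assume that \<open>f\<close> is \<open>t\<close> up to a high order.  A term-by-term approximation only exhibits \<open>f\<close> as an
  infinite product of elements of \<open>H\<close>.  Finite generation makes the product finite: take for each generator
  \<open>g\<close> of \<open>I\<close> two elements of \<open>H\<close> with leading coefficient \<open>g\<close>, in the orders \<open>N\<close> and \<open>N + 1\<close>, and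
  look for \<open>f\<close> as the product of the commutators \<open>[a\<^sub>j, h\<^sub>j]\<close>, where the \<open>h\<^sub>j\<close> are these elements and
  the \<open>a\<^sub>j\<close> are unknown power series.  By \<open>J_commutator_perturbation\<close> the newest coefficients of the
  \<open>a\<^sub>j\<close> enter each degree through a sum of brackets with the generators; such sums
  exhaust \<open>I\<close>, by the same separation of \<open>r g\<close> from \<open>g r\<close>.  The defect to be cancelled in each degree is
  the leading coefficient of a quotient of elements of \<open>H\<close>, so it lies in \<open>I\<close>, and the \<open>a\<^sub>j\<close> can be
  found coefficient by coefficient (\<open>ex_commutator_product\<close>).  As \<open>J(R)\<close> is complete, the \<open>a\<^sub>j\<close> exist
  in \<open>J(R)\<close>, and \<open>f\<close> is a finite product of elements of \<open>H\<close>.\<close>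

section \<open>Series vanishing to a given order\<close>

definition tail :: "nat \<Rightarrow> 'r::ring_1 fps set" where
  "tail p = {d. \<forall>i<p. fps_nth d i = 0}"

lemma tail_zero [simp]: "0 \<in> tail p"
  by (simp add: tail_def)

lemma tail_nth: "d \<in> tail p \<Longrightarrow> i < p \<Longrightarrow> fps_nth d i = 0"
  by (simp add: tail_def)

lemma tail_add: "d \<in> tail p \<Longrightarrow> e \<in> tail p \<Longrightarrow> d + e \<in> tail p"
  by (simp add: tail_def)

lemma tail_diff: "d \<in> tail p \<Longrightarrow> e \<in> tail p \<Longrightarrow> d - e \<in> tail p"
  by (simp add: tail_def)

lemma tail_diff_swap: "d - e \<in> tail p \<Longrightarrow> e - d \<in> tail p"
  by (simp add: tail_def)

lemma tail_diff_trans: "d - e \<in> tail p \<Longrightarrow> e - f \<in> tail p \<Longrightarrow> d - f \<in> tail p"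
  by (simp add: tail_def)

lemma tail_antimono: "d \<in> tail q \<Longrightarrow> p \<le> q \<Longrightarrow> d \<in> tail p"
  by (simp add: tail_def)

lemma tail_Suc_iff: "d \<in> tail (Suc p) \<longleftrightarrow> d \<in> tail p \<and> fps_nth d p = 0"
  by (auto simp: tail_def less_Suc_eq)

lemma tail_all_imp_zero:
  assumes "\<And>p. d \<in> tail (p + c)"
  shows "d = 0"
proof (rule fps_ext)
  fix i
  show "fps_nth d i = fps_nth 0 i"
    using tail_nth[OF assms[of "Suc i"], of i] by simp
qed

lemma tail_mult:
  assumes "x \<in> tail p" "y \<in> tail q"
  shows "x * y \<in> tail (p + q)"
    and "fps_nth (x * y) (p + q) = fps_nth x p * fps_nth y q"
proof -
  have zero: "fps_nth x j * fps_nth y (i - j) = 0" if "i \<le> p + q" "j \<le> i" "j \<noteq> p \<or> i \<noteq> p + q" for i j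
  proof (cases "j < p")
    case True
    then show ?thesis using assms by (simp add: tail_def)
  next
    case False
    then have "i - j < q" using that by linarith
    then show ?thesis using assms by (simp add: tail_def)
  qed
  show "x * y \<in> tail (p + q)"
    unfolding tail_def by (auto simp: fps_mult_nth intro!: sum.neutral zero)
  have "fps_nth (x * y) (p + q) = (\<Sum>j\<in>{0..p + q}. fps_nth x j * fps_nth y (p + q - j))"
    by (simp add: fps_mult_nth)
  also have "\<dots> = (\<Sum>j\<in>{p}. fps_nth x j * fps_nth y (p + q - j))"
    by (rule sum.mono_neutral_right) (auto intro!: zero)
  finally show "fps_nth (x * y) (p + q) = fps_nth x p * fps_nth y q"
    by simp
qed

text \<open>Completeness of the power series in the adic topology: both division in the loop and the
  system of equations for a product of commutators are solved by successive approximation.\<close>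

lemma tail_limit:
  fixes s :: "nat \<Rightarrow> 'r::ring_1 fps"
  assumes step: "\<And>n. s (Suc n) - s n \<in> tail (n + c)"
  obtains z where "\<And>n. z - s n \<in> tail (n + c)"
proof -
  have diff: "s (n + k) - s n \<in> tail (n + c)" for n k
  proof (induction k)
    case (Suc k)
    have "s (Suc (n + k)) - s (n + k) \<in> tail (n + c)"
      using step[of "n + k"] by (rule tail_antimono) simp
    then show ?case using Suc tail_diff_trans by (metis add_Suc_right)
  qed simp
  define z where "z = Abs_fps (\<lambda>i. fps_nth (s (Suc i)) i)"
  have "z - s n \<in> tail (n + c)" for n
    unfolding tail_def
  proof (intro CollectI allI impI)
    fix i assume i: "i < n + c"
    show "fps_nth (z - s n) i = 0"
    proof (cases "n \<le> Suc i")
      case True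
      then show ?thesis
        using tail_nth[OF diff[of n "Suc i - n"] i] by (simp add: z_def)
    next
      case False
      then show ?thesis
        using tail_nth[OF diff[of "Suc i" "n - Suc i"], of i] by (simp add: z_def)
    qed
  qed
  then show thesis by (rule that)
qed

lemma in_Jn_iff:
  assumes "n \<ge> 1"
  shows "f \<in> Jn n \<longleftrightarrow> f - fps_X \<in> tail (n + 1)"
proof
  assume f: "f \<in> Jn n"
  show "f - fps_X \<in> tail (n + 1)"
    unfolding tail_def
  proof (intro CollectI allI impI)
    fix i assume i: "i < n + 1"
    consider "i = 0" | "i = 1" | j where "i = j + 1" "j \<ge> 1" by (cases i; cases "i - 1") auto
    then show "fps_nth (f - fps_X) i = 0"
      using f i by cases (auto simp: Jn_def)
  qed
next
  assume "f - fps_X \<in> tail (n + 1)"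
  then have "fps_nth f i = fps_nth fps_X i" if "i < n + 1" for i
    using that by (auto simp: tail_def)
  then show "f \<in> Jn n" using assms by (auto simp: Jn_def)
qed

lemma in_J_iff: "f \<in> J \<longleftrightarrow> f - fps_X \<in> tail 2"
  using in_Jn_iff[of 1 f] by (simp add: J_eq_Jn_1 numeral_2_eq_2)

lemma Jn_subset_J: "n \<ge> 1 \<Longrightarrow> Jn n \<subseteq> J"
  unfolding J_eq_Jn_1 by (rule Jn_antimono)

lemma fps_X_in_Jn [simp]: "fps_X \<in> Jn n"
  by (auto simp: Jn_def)

lemma fps_X_in_J [simp]: "fps_X \<in> J"
  by (auto simp: J_def)

lemma J_add_tail: "b \<in> J \<Longrightarrow> d \<in> tail k \<Longrightarrow> 2 \<le> k \<Longrightarrow> b + d \<in> J"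
  by (auto simp: J_def tail_def)

lemma J_diff_tail: "a \<in> J \<Longrightarrow> b \<in> J \<Longrightarrow> a - b \<in> tail 2"
  by (auto simp: J_def tail_def less_2_cases_iff)

section \<open>Leading terms of substitutions\<close>

text \<open>At most two coefficients of \<open>b\<^sup>k\<close> below degree \<open>k + n + 1\<close> are nonzero, and they are those of
  the commutative case because \<open>t\<close> is central.\<close>

lemma power_leading_term:
  assumes b: "b \<in> Jn n" and n: "n \<ge> 1"
  shows "b ^ k - fps_X ^ k \<in> tail (k + n) \<and>
    fps_nth (b ^ k - fps_X ^ k) (k + n) = of_nat k * fps_nth b (n + 1)"
proof (induction k)
  case (Suc k)
  define B where "B = b - fps_X"
  define D where "D = b ^ k - fps_X ^ k"
  have B: "B \<in> tail (n + 1)" "fps_nth B (n + 1) = fps_nth b (n + 1)"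
    using b n in_Jn_iff[of n b] by (auto simp: B_def)
  have D: "D \<in> tail (k + n)" "fps_nth D (k + n) = of_nat k * fps_nth b (n + 1)"
    using Suc by (auto simp: D_def)
  have XB: "fps_X ^ k * B \<in> tail (Suc k + n)"
      "fps_nth (fps_X ^ k * B) (Suc k + n) = fps_nth b (n + 1)"
    using B by (auto simp: fps_X_power_mult_nth tail_def)
  have DX: "D * fps_X \<in> tail (Suc k + n)"
      "fps_nth (D * fps_X) (Suc k + n) = of_nat k * fps_nth b (n + 1)"
    using D by (auto simp: tail_def)
  have DB: "D * B \<in> tail (Suc (Suc k + n))"
    by (rule tail_antimono[OF tail_mult(1)[OF D(1) B(1)]]) (use n in simp)
  have "b ^ Suc k - fps_X ^ Suc k = (fps_X ^ k + D) * (fps_X + B) - fps_X ^ k * fps_X"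
    by (simp add: D_def B_def power_commutes)
  then have eq: "b ^ Suc k - fps_X ^ Suc k = fps_X ^ k * B + D * fps_X + D * B"
    by (simp add: algebra_simps)
  show ?case
    unfolding eq
  proof
    show "fps_X ^ k * B + D * fps_X + D * B \<in> tail (Suc k + n)"
      using XB DX DB by (auto intro!: tail_add simp: tail_Suc_iff)
    show "fps_nth (fps_X ^ k * B + D * fps_X + D * B) (Suc k + n) = of_nat (Suc k) * fps_nth b (n + 1)"
      using XB(2) DX(2) DB unfolding tail_Suc_iff fps_add_nth by (simp add: algebra_simps)
  qed
qed simp

text \<open>Substitution is additive in its left argument, so a perturbation there only has to be
  followed through the leading terms of the powers of the right argument.\<close>

lemma compose_left_perturbation:
  assumes d: "d \<in> tail k" and b: "b \<in> Jn n" and n: "n \<ge> 1"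
  shows "fps_compose d b - d \<in> tail (k + n)"
    and "fps_nth (fps_compose d b - d) (k + n) = of_nat k * fps_nth d k * fps_nth b (n + 1)"
proof -
  have pow: "fps_nth (b ^ l) i = (if l = i then 1 else 0)" if "i < l + n" for l i
    using power_leading_term[OF b n, of l] tail_nth[of "b ^ l - fps_X ^ l" "l + n" i] that
    by auto
  have nth: "fps_nth (fps_compose d b - d) i = (\<Sum>l<i. fps_nth d l * fps_nth (b ^ l) i)" for i
    using pow[of i i] n by (simp add: fps_compose_nth atLeast0AtMost lessThan_Suc_atMost[symmetric])
  have zero: "fps_nth d l * fps_nth (b ^ l) i = 0"
    if "l < i" "i \<le> k + n" "l \<noteq> k \<or> i \<noteq> k + n" for l i
  proof (cases "l < k")
    case True
    then show ?thesis using d by (simp add: tail_def)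
  next
    case False
    then have "i < l + n" using that by linarith
    then show ?thesis using pow[of i l] that by simp
  qed
  show "fps_compose d b - d \<in> tail (k + n)"
    unfolding tail_def by (auto simp only: nth intro!: sum.neutral zero)
  have "fps_nth (fps_compose d b - d) (k + n) = (\<Sum>l\<in>{k}. fps_nth d l * fps_nth (b ^ l) (k + n))"
    unfolding nth by (rule sum.mono_neutral_right) (use n in \<open>auto intro!: zero\<close>)
  moreover have "fps_nth (b ^ k) (k + n) = of_nat k * fps_nth b (n + 1)"
    using power_leading_term[OF b n, of k] n by simp
  ultimately show "fps_nth (fps_compose d b - d) (k + n) = of_nat k * fps_nth d k * fps_nth b (n + 1)"
    by simp (metis mult.assoc mult_of_nat_commute)
qed

lemma power_perturbation:
  assumes b: "b \<in> J" and d: "d \<in> tail k" and k: "k \<ge> 2"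
  shows "(b + d) ^ Suc l - b ^ Suc l \<in> tail (k + l) \<and>
    fps_nth ((b + d) ^ Suc l - b ^ Suc l) (k + l) = of_nat (Suc l) * fps_nth d k"
proof (induction l)
  case 0
  then show ?case using d by simp
next
  case (Suc l)
  define E where "E = (b + d) ^ Suc l - b ^ Suc l"
  have bd: "b + d \<in> tail 1" "fps_nth (b + d) 1 = 1"
    using J_add_tail[OF b d k] by (auto simp: J_def tail_def)
  have pw: "b ^ Suc l \<in> tail (Suc l)" "fps_nth (b ^ Suc l) (Suc l) = 1"
  proof -
    have D: "b ^ Suc l - fps_X ^ Suc l \<in> tail (Suc l + 1)"
      using power_leading_term[of b 1 "Suc l"] b by (simp add: J_eq_Jn_1)
    have *: "fps_nth (b ^ Suc l) i = fps_nth (fps_X ^ Suc l) i" if "i < Suc l + 1" for i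
      using tail_nth[OF D that] by (simp del: power_Suc)
    show "b ^ Suc l \<in> tail (Suc l)" "fps_nth (b ^ Suc l) (Suc l) = 1"
      using * by (auto simp: tail_def simp del: power_Suc)
  qed
  have E: "E \<in> tail (k + l)" "fps_nth E (k + l) = of_nat (Suc l) * fps_nth d k"
    using Suc by (auto simp: E_def)
  have eq: "(b + d) ^ Suc (Suc l) - b ^ Suc (Suc l) = E * (b + d) + b ^ Suc l * d"
  proof -
    have "(b + d) ^ Suc (Suc l) - b ^ Suc (Suc l) = (b + d) ^ Suc l * (b + d) - b ^ Suc l * b"
      by (simp only: power_Suc2)
    then show ?thesis unfolding E_def by (simp add: algebra_simps del: power_Suc)
  qed
  have 1: "E * (b + d) \<in> tail (k + Suc l)"
    "fps_nth (E * (b + d)) (k + Suc l) = of_nat (Suc l) * fps_nth d k"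
    using tail_mult[OF E(1) bd(1)] E(2) bd(2) by simp_all
  have 2: "b ^ Suc l * d \<in> tail (k + Suc l)" "fps_nth (b ^ Suc l * d) (k + Suc l) = fps_nth d k"
    using tail_mult[OF pw(1) d] pw(2) by (simp_all add: add.commute)
  show ?case
    unfolding eq
  proof
    show "E * (b + d) + b ^ Suc l * d \<in> tail (k + Suc l)"
      using 1(1) 2(1) by (rule tail_add)
    show "fps_nth (E * (b + d) + b ^ Suc l * d) (k + Suc l) = of_nat (Suc (Suc l)) * fps_nth d k"
      unfolding fps_add_nth 1(2) 2(2) by (simp add: algebra_simps)
  qed
qed

text \<open>Substituting \<open>b + d\<close> for \<open>b\<close> in \<open>b\<^sup>l\<close> produces \<open>l\<close> terms with one factor \<open>d\<close>.  To leading order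
  they all equal \<open>t\<^sup>l\<^sup>-\<^sup>1d\<close>, wherever \<open>d\<close> stands, since \<open>b\<close> starts with the central series \<open>t\<close>.  In
  \<open>f\<close> the linear term contributes \<open>d\<close> itself, and the next nonzero one is that of degree \<open>n + 1\<close>.\<close>

lemma compose_right_perturbation:
  assumes f: "f \<in> Jn n" and n: "n \<ge> 1" and b: "b \<in> J" and d: "d \<in> tail k" and k: "k \<ge> 2"
  shows "fps_compose f (b + d) - fps_compose f b - d \<in> tail (k + n)"
    and "fps_nth (fps_compose f (b + d) - fps_compose f b - d) (k + n) =
      of_nat (n + 1) * fps_nth f (n + 1) * fps_nth d k"
proof -
  define E where "E l = (b + d) ^ l - b ^ l" for l
  have E: "E (Suc l) \<in> tail (k + l)" "fps_nth (E (Suc l)) (k + l) = of_nat (Suc l) * fps_nth d k" for l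
    using power_perturbation[OF b d k, of l] by (auto simp: E_def)
  have E01: "E 0 = 0" "E (Suc 0) = d" by (auto simp: E_def)
  have f01: "fps_nth f 0 = 0" "fps_nth f (Suc 0) = 1" using f by (auto simp: Jn_def)
  have nth: "fps_nth (fps_compose f (b + d) - fps_compose f b - d) i =
      (\<Sum>l\<in>{2..i}. fps_nth f l * fps_nth (E l) i)" for i
  proof -
    have "fps_nth (fps_compose f (b + d) - fps_compose f b) i = (\<Sum>l\<in>{0..i}. fps_nth f l * fps_nth (E l) i)"
      by (simp add: fps_compose_nth E_def sum_subtractf algebra_simps)
    also have "\<dots> = fps_nth d i + (\<Sum>l\<in>{2..i}. fps_nth f l * fps_nth (E l) i)"
    proof (cases "i = 0")
      case True
      then show ?thesis using f01 d k by (simp add: tail_def)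
    next
      case False
      then show ?thesis
        using f01 E01 by (simp add: sum.atLeast_Suc_atMost numeral_2_eq_2)
    qed
    finally show ?thesis by simp
  qed
  have zero: "fps_nth f l * fps_nth (E l) i = 0"
    if "2 \<le> l" "i \<le> k + n" "l \<noteq> n + 1 \<or> i \<noteq> k + n" for l i
  proof (cases "l < n + 1")
    case True
    then show ?thesis using f that(1) unfolding Jn_def
      by (auto dest!: spec[of _ "l - 1"])
  next
    case False
    then obtain m where m: "l = Suc m" "m \<ge> n" by (cases l) auto
    then have "i < k + m" using that by linarith
    then show ?thesis using tail_nth[OF E(1)] m by simp
  qed
  show "fps_compose f (b + d) - fps_compose f b - d \<in> tail (k + n)"
    unfolding tail_def by (auto simp only: nth intro!: sum.neutral zero) simp_all
  have "fps_nth (fps_compose f (b + d) - fps_compose f b - d) (k + n) =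
      (\<Sum>l\<in>{n + 1}. fps_nth f l * fps_nth (E l) (k + n))"
    unfolding nth by (rule sum.mono_neutral_right) (use n k in \<open>auto intro!: zero\<close>)
  then show "fps_nth (fps_compose f (b + d) - fps_compose f b - d) (k + n) =
      of_nat (n + 1) * fps_nth f (n + 1) * fps_nth d k"
    using E(2)[of n] by simp (metis mult.assoc mult_of_nat_commute of_nat_Suc)
qed

lemma compose_right_congruence:
  assumes "f \<in> J" "b \<in> J" "d \<in> tail k" "k \<ge> 2"
  shows "fps_compose f (b + d) - fps_compose f b - d \<in> tail (Suc k)"
  using compose_right_perturbation(1)[of f 1 b d k] assms by (simp add: J_eq_Jn_1)

lemma compose_left_congruence:
  assumes "d \<in> tail k" "b \<in> J"
  shows "fps_compose d b - d \<in> tail (Suc k)"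
  using compose_left_perturbation(1)[of d k b 1] assms by (simp add: J_eq_Jn_1)

text \<open>To leading order the loop product is addition.\<close>

lemma compose_product_congruence:
  assumes "a \<in> J" "a' \<in> J" "b \<in> J" "b' \<in> J" and a: "a' - a \<in> tail k" and b: "b' - b \<in> tail k"
    and "k \<ge> 2"
  shows "fps_compose a' b' - fps_compose a b - (a' - a) - (b' - b) \<in> tail (Suc k)"
proof -
  have "fps_compose (a' - a) b' - (a' - a) \<in> tail (Suc k)"
    using a assms by (intro compose_left_congruence)
  moreover have "fps_compose a (b + (b' - b)) - fps_compose a b - (b' - b) \<in> tail (Suc k)"
    using assms by (intro compose_right_congruence)
  ultimately show ?thesis
    by (auto dest: tail_add simp: fps_compose_sub_distrib algebra_simps)
qed

lemma compose_fps_X_right: "fps_compose f fps_X = (f :: 'r::ring_1 fps)"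
  by (simp add: fps_eq_iff fps_compose_def mult_delta_right)

lemma compose_fps_X_left: "f \<in> J \<Longrightarrow> fps_compose fps_X f = f"
  by (auto simp: J_def fps_eq_iff fps_compose_nth mult_delta_left not_le less_Suc_eq)

section \<open>Division and commutators\<close>

text \<open>By \<open>compose_right_congruence\<close>, a factor \<open>z\<close> and the product \<open>x \<circ> z\<close> determine each
  other order by order, with the same leading difference.\<close>

lemma compose_left_cancel:
  assumes "x \<in> J" "z \<in> J" "z' \<in> J" and p: "p \<ge> 2"
    and diff: "fps_compose x z' - fps_compose x z \<in> tail p"
  shows "z' - z \<in> tail p"
    and "fps_nth (z' - z) p = fps_nth (fps_compose x z' - fps_compose x z) p"
proof -
  have approx: "fps_compose x z' - fps_compose x z - (z' - z) \<in> tail (Suc q)"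
    if "z' - z \<in> tail q" "q \<ge> 2" for q
    using compose_right_congruence[of x z "z' - z" q] that assms by simp
  show *: "z' - z \<in> tail p"
    using p diff
  proof (induction p rule: dec_induct)
    case base
    then show ?case using assms by (intro J_diff_tail)
  next
    case (step q)
    then have "z' - z \<in> tail q" by (simp add: tail_Suc_iff)
    with step.hyps have "fps_compose x z' - fps_compose x z - (z' - z) \<in> tail (Suc q)"
      by (intro approx) simp_all
    with step.prems show ?case by (simp add: tail_def)
  qed
  show "fps_nth (z' - z) p = fps_nth (fps_compose x z' - fps_compose x z) p"
    using tail_nth[OF approx[OF * p], of p] by simp
qed

lemma ex_left_quotient:
  assumes x: "x \<in> J" and y: "y \<in> J"
  shows "\<exists>z\<in>J. fps_compose x z = y"
proof -
  \<comment> \<open>Each round adds the current error to the approximation, which by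
    \<open>compose_right_congruence\<close> raises the order of the error.\<close>
  define s where "s = rec_nat fps_X (\<lambda>_ z. z + (y - fps_compose x z))"
  have s0: "s 0 = fps_X" and sSuc: "s (Suc n) = s n + (y - fps_compose x (s n))" for n
    by (simp_all add: s_def)
  have inv: "s n \<in> J \<and> y - fps_compose x (s n) \<in> tail (n + 2)" for n
  proof (induction n)
    case 0
    then show ?case using J_diff_tail[OF y x] by (simp add: s0 compose_fps_X_right numeral_2_eq_2)
  next
    case (Suc n)
    define e where "e = y - fps_compose x (s n)"
    have e: "e \<in> tail (n + 2)" using Suc by (simp add: e_def)
    have "fps_compose x (s n + e) - fps_compose x (s n) - e \<in> tail (Suc (n + 2))"
      using Suc e x by (intro compose_right_congruence) auto
    then have "y - fps_compose x (s n + e) \<in> tail (Suc (n + 2))"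
      by (simp add: e_def tail_def)
    then show ?case
      using Suc e J_add_tail[of "s n" e "n + 2"] by (simp add: sSuc e_def)
  qed
  then have "s (Suc n) - s n \<in> tail (n + 2)" for n
    by (simp add: sSuc)
  then obtain z where z: "\<And>n. z - s n \<in> tail (n + 2)"
    using tail_limit by blast
  have zJ: "z \<in> J" using z[of 0] by (simp add: s0 in_J_iff numeral_2_eq_2)
  have "y - fps_compose x z \<in> tail (n + 2)" for n
  proof -
    have "fps_compose x (s n + (z - s n)) - fps_compose x (s n) - (z - s n) \<in> tail (Suc (n + 2))"
      using inv z x by (intro compose_right_congruence) auto
    then have "fps_compose x z - fps_compose x (s n) \<in> tail (n + 2)"
      using z[of n] by (simp add: tail_def)
    then show ?thesis using inv[of n] by (simp add: tail_def)
  qed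
  then have "y - fps_compose x z = 0" by (rule tail_all_imp_zero)
  then show ?thesis using zJ by auto
qed

lemma left_quotient_unique:
  assumes "x \<in> J" "z \<in> J" "z' \<in> J" "fps_compose x z = fps_compose x z'"
  shows "z = z'"
proof -
  have "z' - z \<in> tail (p + 2)" for p
    by (rule compose_left_cancel(1)[of x]) (use assms in auto)
  then have "z' - z = 0" by (rule tail_all_imp_zero)
  then show ?thesis by simp
qed

lemma J_ldiv:
  assumes "x \<in> J" "y \<in> J"
  shows "J_ldiv x y \<in> J" and "fps_compose x (J_ldiv x y) = y"
proof -
  have "\<exists>!z. z \<in> J \<and> fps_compose x z = y"
    using ex_left_quotient[OF assms] left_quotient_unique[OF assms(1)] by metis
  then have "J_ldiv x y \<in> J \<and> fps_compose x (J_ldiv x y) = y"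
    unfolding J_ldiv_def by (rule theI')
  then show "J_ldiv x y \<in> J" "fps_compose x (J_ldiv x y) = y" by auto
qed

lemma J_ldiv_eqI:
  assumes "x \<in> J" "z \<in> J" "fps_compose x z = y"
  shows "J_ldiv x y = z"
  using J_ldiv[of x y] left_quotient_unique[of x "J_ldiv x y" z] fps_compose_in_J[of x z] assms by auto

lemma J_ldiv_congruence:
  assumes "x \<in> J" "y \<in> J" "y' \<in> J" "p \<ge> 2" "y' - y \<in> tail p"
  shows "J_ldiv x y' - J_ldiv x y \<in> tail p"
    and "fps_nth (J_ldiv x y' - J_ldiv x y) p = fps_nth (y' - y) p"
  using compose_left_cancel[of x "J_ldiv x y" "J_ldiv x y'" p] assms
  by (simp_all add: J_ldiv)

lemma J_ldiv_self: "x \<in> J \<Longrightarrow> J_ldiv x x = fps_X"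
  by (rule J_ldiv_eqI) (auto simp: compose_fps_X_right)

lemma J_commutator:
  assumes "a \<in> J" "h \<in> J"
  shows "J_commutator a h \<in> J"
    and "fps_compose (fps_compose h a) (J_commutator a h) = fps_compose a h"
  using J_ldiv[of "fps_compose h a" "fps_compose a h"] fps_compose_in_J assms
  by (auto simp: J_commutator_def)

lemma J_commutator_fps_X: "h \<in> J \<Longrightarrow> J_commutator fps_X h = fps_X"
  by (simp add: J_commutator_def compose_fps_X_right compose_fps_X_left J_ldiv_self)

text \<open>Both \<open>a \<circ> h\<close> and \<open>h \<circ> a\<close> agree with \<open>a + h - t\<close> up to degree \<open>n + 1\<close>, so the commutator is
  trivial to one order more than \<open>h\<close>.\<close>

lemma J_commutator_order:
  assumes a: "a \<in> J" and h: "h \<in> Jn n" and n: "n \<ge> 1"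
  shows "J_commutator a h \<in> Jn (Suc n)"
proof -
  have hJ: "h \<in> J" using h n Jn_subset_J by blast
  define x where "x = fps_compose h a"
  define y where "y = fps_compose a h"
  have xJ: "x \<in> J" and yJ: "y \<in> J" using a hJ fps_compose_in_J by (auto simp: x_def y_def)
  have a1: "a \<in> tail 1" "fps_nth a 1 = 1" using a by (auto simp: J_def tail_def)
  have "y - a \<in> tail (1 + n)" "fps_nth (y - a) (1 + n) = fps_nth h (n + 1)"
    using compose_left_perturbation[OF a1(1) h n] a1(2) by (simp_all add: y_def)
  moreover have "x - h - (a - fps_X) \<in> tail (2 + n)"
    using compose_right_perturbation(1)[OF h n fps_X_in_J, of "a - fps_X" 2] a
    by (simp add: x_def in_J_iff compose_fps_X_right)
  moreover have "h - fps_X \<in> tail (n + 1)"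
    using h n in_Jn_iff by blast
  ultimately have "y - x \<in> tail (n + 2)"
    using n by (simp add: tail_Suc_iff) (auto simp: tail_def diff_eq_eq add.commute)
  then have "J_ldiv x y - J_ldiv x x \<in> tail (n + 2)"
    using J_ldiv_congruence(1)[of x x y "n + 2"] xJ yJ by simp
  then show ?thesis
    using in_Jn_iff[of "Suc n" "J_commutator a h"] by (simp add: J_commutator_def x_def y_def J_ldiv_self[OF xJ[unfolded x_def]])
qed

text \<open>Compare \<open>(h \<circ> a) \<circ> [a, h] = a \<circ> h\<close> with the same equation for \<open>a + d\<close>.  On the right, \<open>d\<close>
  contributes \<open>d \<circ> h\<close>; on the left, \<open>h \<circ> (a + d) - h \<circ> a\<close>.  Both equal \<open>d\<close> below degree \<open>k + n\<close>,
  where the two leading corrections differ and the commutator has to make up the difference.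
  The substitution of the new commutator on the left does not blur this, because it is
  trivial to one order more than \<open>h\<close>.\<close>

lemma J_commutator_perturbation:
  assumes a: "a \<in> J" and d: "d \<in> tail k" and k: "k \<ge> 2" and h: "h \<in> Jn n" and n: "n \<ge> 1"
  shows "J_commutator (a + d) h - J_commutator a h \<in> tail (k + n)"
    and "fps_nth (J_commutator (a + d) h - J_commutator a h) (k + n) =
      of_nat k * fps_nth d k * fps_nth h (n + 1) - of_nat (n + 1) * fps_nth h (n + 1) * fps_nth d k"
proof -
  have hJ: "h \<in> J" using h n Jn_subset_J by blast
  have a'J: "a + d \<in> J" using J_add_tail[OF a d k] .
  define c where "c = J_commutator a h"
  define c' where "c' = J_commutator (a + d) h"
  define x where "x = fps_compose h a"
  define e where "e = fps_compose h (a + d) - x"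
  have c: "c \<in> J" "fps_compose x c = fps_compose a h"
    using J_commutator[OF a hJ] by (auto simp: c_def x_def)
  have c': "c' \<in> J" "fps_compose (x + e) c' = fps_compose (a + d) h"
    using J_commutator[OF a'J hJ] by (auto simp: c'_def e_def)
  have c'n: "c' \<in> Jn (Suc n)" using J_commutator_order[OF a'J h n] by (simp add: c'_def)
  have xJ: "x \<in> J" using a hJ fps_compose_in_J by (auto simp: x_def)
  have e: "e - d \<in> tail (k + n)"
    "fps_nth (e - d) (k + n) = of_nat (n + 1) * fps_nth h (n + 1) * fps_nth d k"
    using compose_right_perturbation[OF h n a d k] by (simp_all add: e_def x_def)
  have "e \<in> tail k"
    using tail_add[OF tail_antimono[OF e(1)] d] by simp
  then have ec: "fps_compose e c' - e \<in> tail (Suc (k + n))"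
    using compose_left_perturbation(1)[OF _ c'n] by simp
  have dh: "fps_compose d h - d \<in> tail (k + n)"
    "fps_nth (fps_compose d h - d) (k + n) = of_nat k * fps_nth d k * fps_nth h (n + 1)"
    using compose_left_perturbation[OF d h n] by simp_all
  have eq: "fps_compose x c' - fps_compose x c =
      (fps_compose d h - d) - (e - d) - (fps_compose e c' - e)"
    using c c' by (simp add: fps_compose_add_distrib algebra_simps)
  have diff: "fps_compose x c' - fps_compose x c \<in> tail (k + n)"
    unfolding eq by (rule tail_diff[OF tail_diff[OF dh(1) e(1)]]) (use ec in \<open>simp add: tail_Suc_iff\<close>)
  have coeff: "fps_nth (fps_compose x c' - fps_compose x c) (k + n) =
      of_nat k * fps_nth d k * fps_nth h (n + 1) - of_nat (n + 1) * fps_nth h (n + 1) * fps_nth d k"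
    unfolding eq fps_sub_nth[of "_ - _ - _"] fps_sub_nth[of "fps_compose d h - d"]
    unfolding e(2) dh(2) using ec by (simp add: tail_Suc_iff)
  show "J_commutator (a + d) h - J_commutator a h \<in> tail (k + n)"
    using compose_left_cancel(1)[OF xJ c(1) c'(1) _ diff] k by (simp add: c_def c'_def)
  show "fps_nth (J_commutator (a + d) h - J_commutator a h) (k + n) =
      of_nat k * fps_nth d k * fps_nth h (n + 1) - of_nat (n + 1) * fps_nth h (n + 1) * fps_nth d k"
    using compose_left_cancel(2)[OF xJ c(1) c'(1) _ diff] coeff k by (simp add: c_def c'_def)
qed

section \<open>Solving for a product of commutators\<close>

text \<open>For \<open>m, n \<ge> 1\<close> this is the coefficient of \<open>t\<^sup>m\<^sup>+\<^sup>n\<^sup>+\<^sup>1\<close> in the commutator of \<open>t + r t\<^sup>m\<^sup>+\<^sup>1\<close> with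
  \<open>t + \<alpha> t\<^sup>n\<^sup>+\<^sup>1\<close>; over a commutative ring it is the Witt bracket \<open>(m - n) r \<alpha>\<close>.\<close>

definition bracket :: "nat \<Rightarrow> nat \<Rightarrow> 'r::ring_1 \<Rightarrow> 'r \<Rightarrow> 'r" where
  "bracket n m r \<alpha> = of_nat (m + 1) * r * \<alpha> - of_nat (n + 1) * \<alpha> * r"

primrec iterated_product :: "(nat \<Rightarrow> 'r::ring_1 fps) \<Rightarrow> nat \<Rightarrow> 'r fps" where
  "iterated_product c 0 = fps_X"
| "iterated_product c (Suc k) = fps_compose (c k) (iterated_product c k)"

lemma iterated_product_in_J: "(\<And>j. j < k \<Longrightarrow> c j \<in> J) \<Longrightarrow> iterated_product c k \<in> J"
  by (induction k) (auto intro: fps_compose_in_J)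

lemma iterated_product_fps_X: "(\<And>j. j < k \<Longrightarrow> c j = fps_X) \<Longrightarrow> iterated_product c k = fps_X"
  by (induction k) (simp_all add: compose_fps_X_right)

lemma iterated_product_perturbation:
  assumes p: "p \<ge> 2"
    and "\<And>j. j < k \<Longrightarrow> c j \<in> J" "\<And>j. j < k \<Longrightarrow> c' j \<in> J" "\<And>j. j < k \<Longrightarrow> c' j - c j \<in> tail p"
  shows "iterated_product c' k - iterated_product c k \<in> tail p \<and>
    fps_nth (iterated_product c' k - iterated_product c k) p = (\<Sum>j<k. fps_nth (c' j - c j) p)"
  using assms(2-)
proof (induction k)
  case (Suc k)
  let ?P = "iterated_product c k" and ?P' = "iterated_product c' k"
  have IH: "?P' - ?P \<in> tail p" "fps_nth (?P' - ?P) p = (\<Sum>j<k. fps_nth (c' j - c j) p)"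
    using Suc by simp_all
  have k: "c' k - c k \<in> tail p" using Suc.prems by simp
  have err: "fps_compose (c' k) ?P' - fps_compose (c k) ?P - (c' k - c k) - (?P' - ?P) \<in> tail (Suc p)"
    using p IH(1) Suc.prems by (intro compose_product_congruence) (auto intro: iterated_product_in_J)
  define e where "e = fps_compose (c' k) ?P' - fps_compose (c k) ?P - (c' k - c k) - (?P' - ?P)"
  have eq: "fps_compose (c' k) ?P' - fps_compose (c k) ?P = (c' k - c k) + (?P' - ?P) + e"
    by (simp add: e_def)
  have e: "e \<in> tail p" "fps_nth e p = 0" using err by (auto simp: e_def tail_Suc_iff)
  show ?case
    unfolding iterated_product.simps eq
  proof
    show "(c' k - c k) + (?P' - ?P) + e \<in> tail p"
      using k IH(1) e(1) by (intro tail_add)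
    show "fps_nth ((c' k - c k) + (?P' - ?P) + e) p = (\<Sum>j<Suc k. fps_nth (c' j - c j) p)"
      unfolding fps_add_nth IH(2) e(2) by (simp add: add.commute)
  qed
qed simp

text \<open>In each degree the unknown series \<open>a\<^sub>j\<close> enter the equation through brackets of their newest
  coefficients with the leading coefficients of the \<open>h\<^sub>j\<close>, plus terms in coefficients that are
  already fixed.  So it suffices that the defect can be written as a sum of brackets in every
  degree.  The infinitely many coefficients of \<open>u\<close> are thus absorbed into \<open>K\<close> factors.\<close>

lemma ex_commutator_product:
  fixes h :: "nat \<Rightarrow> 'r::ring_1 fps" and K :: nat
  defines "C \<equiv> \<lambda>a. iterated_product (\<lambda>j. J_commutator (a j) (h j)) K"
  assumes h: "\<And>j. j < K \<Longrightarrow> h j \<in> Jn (n j)"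
    and n: "\<And>j. j < K \<Longrightarrow> 1 \<le> n j" "\<And>j. j < K \<Longrightarrow> n j < N"
    and u: "u \<in> Jn N" and N: "N \<ge> 1"
    and defect: "\<And>a M. (\<And>j. a j \<in> J) \<Longrightarrow> N \<le> M \<Longrightarrow> u - C a \<in> tail (M + 1) \<Longrightarrow>
      \<exists>r. fps_nth (u - C a) (M + 1) = (\<Sum>j<K. bracket (n j) (M - n j) (r j) (fps_nth (h j) (n j + 1)))"
  shows "\<exists>a. (\<forall>j. a j \<in> J) \<and> C a = u"
proof -
  have hJ: "h j \<in> J" if "j < K" for j
    using h n(1) Jn_subset_J that by blast
  have change: "C a' - C a \<in> tail (M + 1) \<and> fps_nth (C a' - C a) (M + 1) =
      (\<Sum>j<K. bracket (n j) (M - n j) (fps_nth (a' j - a j) (M - n j + 1)) (fps_nth (h j) (n j + 1)))"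
    if M: "N \<le> M" and aJ: "\<And>j. a j \<in> J" "\<And>j. a' j \<in> J"
      and a: "\<And>j. j < K \<Longrightarrow> a' j - a j \<in> tail (M - n j + 1)" for a a' M
  proof -
    have c: "J_commutator (a' j) (h j) - J_commutator (a j) (h j) \<in> tail (M + 1)"
      "fps_nth (J_commutator (a' j) (h j) - J_commutator (a j) (h j)) (M + 1) =
        bracket (n j) (M - n j) (fps_nth (a' j - a j) (M - n j + 1)) (fps_nth (h j) (n j + 1))"
      if j: "j < K" for j
    proof -
      have eq: "M - n j + 1 + n j = M + 1" "M - n j + 1 \<ge> 2" using n(2)[OF j] M by auto
      have "a' j = a j + (a' j - a j)" by simp
      then show "J_commutator (a' j) (h j) - J_commutator (a j) (h j) \<in> tail (M + 1)"
        "fps_nth (J_commutator (a' j) (h j) - J_commutator (a j) (h j)) (M + 1) =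
          bracket (n j) (M - n j) (fps_nth (a' j - a j) (M - n j + 1)) (fps_nth (h j) (n j + 1))"
        using J_commutator_perturbation[OF aJ(1)[of j] a[OF j] eq(2) h[OF j] n(1)[OF j]] eq(1)
        unfolding bracket_def by metis+
    qed
    have *: "C a' - C a \<in> tail (M + 1) \<and> fps_nth (C a' - C a) (M + 1) =
        (\<Sum>j<K. fps_nth (J_commutator (a' j) (h j) - J_commutator (a j) (h j)) (M + 1))"
      unfolding C_def
      by (rule iterated_product_perturbation) (use c(1) M N aJ hJ in \<open>simp_all add: J_commutator(1)\<close>)
    moreover have "(\<Sum>j<K. fps_nth (J_commutator (a' j) (h j) - J_commutator (a j) (h j)) (M + 1)) =
        (\<Sum>j<K. bracket (n j) (M - n j) (fps_nth (a' j - a j) (M - n j + 1)) (fps_nth (h j) (n j + 1)))"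
      by (rule sum.cong[OF refl], rule c(2)) simp
    ultimately show ?thesis by simp
  qed
  \<comment> \<open>Stage \<open>i\<close> satisfies the equation up to degree \<open>N + i\<close>.  To correct degree \<open>N + i + 1\<close> the
    series \<open>a\<^sub>j\<close> is changed from degree \<open>N + i - n\<^sub>j + 1\<close> on, which is at least \<open>2\<close> as \<open>n\<^sub>j < N\<close>.\<close>
  define P where "P i a \<longleftrightarrow> (\<forall>j. a j \<in> J) \<and> u - C a \<in> tail (N + i + 1)" for i a
  define Q where "Q i a a' \<longleftrightarrow> (\<forall>j<K. a' j - a j \<in> tail (i + (N - n j + 1)))"
    for i and a a' :: "nat \<Rightarrow> 'r fps"
  have "\<exists>s. \<forall>i. P i (s i) \<and> Q i (s i) (s (Suc i))"
  proof (rule dependent_nat_choice)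
    have "C (\<lambda>_. fps_X) = fps_X"
      unfolding C_def by (rule iterated_product_fps_X) (simp add: J_commutator_fps_X hJ)
    then show "\<exists>a. P 0 a"
      using u in_Jn_iff[OF N, of u] by (intro exI[of _ "\<lambda>_. fps_X"]) (simp add: P_def)
  next
    fix a i assume "P i a"
    then have aJ: "\<And>j. a j \<in> J" and ua: "u - C a \<in> tail (N + i + 1)" by (auto simp: P_def)
    obtain r where r: "fps_nth (u - C a) (N + i + 1) =
        (\<Sum>j<K. bracket (n j) (N + i - n j) (r j) (fps_nth (h j) (n j + 1)))"
      using defect[of a "N + i"] aJ ua by auto
    define a' where "a' j = (if j < K then a j + fps_const (r j) * fps_X ^ (N + i - n j + 1) else a j)" for j
    have tail: "a' j - a j \<in> tail (N + i - n j + 1)" and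
      coeff: "fps_nth (a' j - a j) (Suc (N + i - n j)) = r j" if "j < K" for j
      using that by (auto simp: a'_def tail_def)
    have a'J: "a' j \<in> J" for j
    proof (cases "j < K")
      case True
      have "a j + (a' j - a j) \<in> J"
        by (rule J_add_tail[OF aJ tail[OF True]]) (use n(2)[OF True] in simp)
      then show ?thesis by simp
    qed (simp add: a'_def aJ)
    have change': "C a' - C a \<in> tail (N + i + 1)"
      "fps_nth (C a' - C a) (N + i + 1) = fps_nth (u - C a) (N + i + 1)"
      using change[of "N + i" a a'] aJ a'J tail unfolding r
      by (auto simp: coeff simp del: fps_sub_nth intro!: sum.cong)
    have "u - C a' = (u - C a) - (C a' - C a)" by simp
    then have "u - C a' \<in> tail (N + i + 1)" "fps_nth (u - C a') (N + i + 1) = 0"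
      using tail_diff[OF ua change'(1)] change'(2) by simp_all
    then have "P (Suc i) a'" using a'J by (simp add: P_def tail_Suc_iff)
    moreover have "Q i a a'"
      unfolding Q_def
    proof (intro allI impI)
      fix j assume j: "j < K"
      show "a' j - a j \<in> tail (i + (N - n j + 1))"
        by (rule tail_antimono[OF tail[OF j]]) (use n(2)[OF j] in simp)
    qed
    ultimately show "\<exists>a'. P (Suc i) a' \<and> Q i a a'" by (intro exI conjI)
  qed
  then obtain s where "\<forall>i. P i (s i) \<and> Q i (s i) (s (Suc i))" by (rule exE)
  then have s: "P i (s i)" "Q i (s i) (s (Suc i))" for i by simp_all
  have "\<exists>z. \<forall>i. z - s i j \<in> tail (i + (N - n j + 1))" if j: "j < K" for j
  proof -
    have "s (Suc i) j - s i j \<in> tail (i + (N - n j + 1))" for i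
      using s(2)[of i] j by (simp add: Q_def)
    then show ?thesis by (rule tail_limit) auto
  qed
  then obtain z where z: "\<And>i j. j < K \<Longrightarrow> z j - s i j \<in> tail (i + (N - n j + 1))" by metis
  define A where "A j = (if j < K then z j else fps_X)" for j
  have AJ: "A j \<in> J" for j
  proof (cases "j < K")
    case True
    have "s 0 j + (z j - s 0 j) \<in> J"
      by (rule J_add_tail[OF _ z[OF True]]) (use s(1)[of 0] n(2)[OF True] in \<open>auto simp: P_def\<close>)
    then show ?thesis using True by (simp add: A_def)
  qed (simp add: A_def)
  have "u - C A \<in> tail (i + (N + 1))" for i
  proof -
    have "A j - s i j \<in> tail (N + i - n j + 1)" if "j < K" for j
      using z[OF that, of i] n(2)[OF that] that by (simp add: A_def add.commute)
    then have "C A - C (s i) \<in> tail (N + i + 1)"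
      using change[of "N + i" "s i" A] AJ s(1)[of i] unfolding P_def by auto
    moreover have "u - C (s i) \<in> tail (N + i + 1)" using s(1)[of i] by (simp add: P_def)
    ultimately have "(u - C (s i)) - (C A - C (s i)) \<in> tail (N + i + 1)" by (rule tail_diff[rotated])
    then show ?thesis by (simp add: add_ac)
  qed
  then have "u - C A = 0" by (rule tail_all_imp_zero)
  then show ?thesis using AJ by auto
qed

section \<open>Leading coefficients of a commutator-invariant subloop\<close>

locale commutator_invariant_subloop =
  fixes H :: "'r::ring_1 fps set"
  assumes subloop: "is_subloop H J fps_compose fps_X"
    and commutator_closed: "a \<in> J \<Longrightarrow> h \<in> H \<Longrightarrow> J_commutator a h \<in> H"
    and ex_of_nat_inverse: "k > 0 \<Longrightarrow> \<exists>q::'r. of_nat k * q = 1"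
begin

lemma H_subset_J: "H \<subseteq> J"
  using subloop by (simp add: is_subloop_def)

lemma fps_X_in_H: "fps_X \<in> H"
  using subloop by (simp add: is_subloop_def is_loop_def)

lemma compose_in_H: "a \<in> H \<Longrightarrow> b \<in> H \<Longrightarrow> fps_compose a b \<in> H"
  using subloop by (simp add: is_subloop_def is_loop_def)

lemma ldiv_in_H:
  assumes "a \<in> H" "b \<in> H"
  shows "J_ldiv a b \<in> H"
proof -
  have "\<exists>!z. z \<in> H \<and> fps_compose a z = b"
    using subloop assms by (simp add: is_subloop_def is_loop_def)
  then obtain z where "z \<in> H" "fps_compose a z = b" by (elim ex1E conjE)
  moreover from this have "J_ldiv a b = z"
    using assms H_subset_J by (intro J_ldiv_eqI) auto
  ultimately show ?thesis by simp
qed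

lemma iterated_product_in_H: "(\<And>j. j < k \<Longrightarrow> c j \<in> H) \<Longrightarrow> iterated_product c k \<in> H"
  by (induction k) (auto intro: compose_in_H fps_X_in_H)

text \<open>The factor from \<open>Jn (n + 1)\<close> in the definition of the leading coefficients only affects
  degrees above \<open>n + 1\<close>, so it can be absorbed.\<close>

lemma lead_coeffs_iff:
  assumes n: "n \<ge> 1"
  shows "\<alpha> \<in> lead_coeffs H n \<longleftrightarrow> (\<exists>h\<in>H. h \<in> Jn n \<and> fps_nth h (n + 1) = \<alpha>)"
proof
  let ?y = "fps_X + fps_const \<alpha> * fps_X ^ (n + 1) :: 'r fps"
  have y: "?y \<in> J" "?y - fps_X \<in> tail (n + 1)" "fps_nth (?y - fps_X) (n + 1) = \<alpha>"
    using n by (auto simp: J_def tail_def)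
  {
    assume "\<alpha> \<in> lead_coeffs H n"
    then obtain h u where hu: "h \<in> H" "u \<in> Jn (n + 1)" "?y = fps_compose h u"
      by (auto simp: lead_coeffs_def)
    have u: "u - fps_X \<in> tail (n + 2)" using hu(2) in_Jn_iff[of "n + 1" u] by simp
    have "fps_compose h (fps_X + (u - fps_X)) - fps_compose h fps_X - (u - fps_X) \<in> tail (Suc (n + 2))"
      by (intro compose_right_congruence) (use hu u H_subset_J in auto)
    then have "?y - h \<in> tail (n + 2)"
      using u hu(3) by (simp add: compose_fps_X_right tail_def)
    then have hy: "h - ?y \<in> tail (Suc (n + 1))" using tail_diff_swap by simp
    have "h - fps_X \<in> tail (n + 1)"
      using tail_diff_trans[OF tail_antimono[OF hy] y(2)] by simp
    moreover have "fps_nth h (n + 1) = \<alpha>"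
      using tail_nth[OF hy, of "n + 1"] n by simp
    ultimately show "\<exists>h\<in>H. h \<in> Jn n \<and> fps_nth h (n + 1) = \<alpha>"
      using hu(1) in_Jn_iff[OF n, of h] by blast
  }
  {
    assume "\<exists>h\<in>H. h \<in> Jn n \<and> fps_nth h (n + 1) = \<alpha>"
    then obtain h where h: "h \<in> H" "h \<in> Jn n" "fps_nth h (n + 1) = \<alpha>" by blast
    have hJ: "h \<in> J" using h H_subset_J by blast
    have cancel: "(a - b) + (b - c) = a - c" for a b c :: "'r fps" by simp
    have hX: "fps_X - h \<in> tail (n + 1)" "fps_nth (fps_X - h) (n + 1) = - \<alpha>"
      using h(2) in_Jn_iff[OF n, of h] tail_diff_swap[of h] h(3) n by auto
    have "(?y - fps_X) + (fps_X - h) \<in> tail (Suc (n + 1))"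
      unfolding tail_Suc_iff using tail_add[OF y(2) hX(1)] y(3) hX(2)
      unfolding fps_add_nth by simp
    moreover have "(?y - fps_X) + (fps_X - h) = ?y - h"
      using cancel by blast
    ultimately have "?y - h \<in> tail (n + 2)" by (metis add_2_eq_Suc' Suc_eq_plus1)
    then have "J_ldiv h ?y - J_ldiv h h \<in> tail (n + 2)"
      using hJ y(1) by (intro J_ldiv_congruence(1)) auto
    then have "J_ldiv h ?y \<in> Jn (n + 1)"
      using in_Jn_iff[of "n + 1" "J_ldiv h ?y"] hJ by (simp add: J_ldiv_self)
    moreover have "?y = fps_compose h (J_ldiv h ?y)" using J_ldiv(2)[OF hJ y(1)] by simp
    ultimately show "\<alpha> \<in> lead_coeffs H n"
      unfolding lead_coeffs_def using h(1) by blast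
  }
qed

lemma lead_coeffsI:
  assumes "n \<ge> 1" "h \<in> H" "h \<in> Jn n" "fps_nth h (n + 1) = \<alpha>"
  shows "\<alpha> \<in> lead_coeffs H n"
  unfolding lead_coeffs_iff[OF assms(1)] by (intro bexI conjI) (rule assms)+

lemma lead_coeffsE:
  assumes "n \<ge> 1" "\<alpha> \<in> lead_coeffs H n"
  obtains h where "h \<in> H" "h \<in> Jn n" "fps_nth h (n + 1) = \<alpha>"
  using assms(2) unfolding lead_coeffs_iff[OF assms(1)] by (elim bexE conjE)

text \<open>The difference is the leading coefficient of the quotient of \<open>h'\<close> by \<open>h\<close>.\<close>

lemma leading_difference:
  assumes n: "n \<ge> 1" and h: "h \<in> H" "h' \<in> H" "h' - h \<in> tail (n + 1)"
  shows "fps_nth (h' - h) (n + 1) \<in> lead_coeffs H n"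
proof -
  have J: "h \<in> J" "h' \<in> J" using h H_subset_J by auto
  have *: "J_ldiv h h' - fps_X \<in> tail (n + 1)"
    "fps_nth (J_ldiv h h' - fps_X) (n + 1) = fps_nth (h' - h) (n + 1)"
    using J_ldiv_congruence[OF J(1) J(1) J(2) _ h(3)] n J by (auto simp: J_ldiv_self)
  show ?thesis
  proof (rule lead_coeffsI[OF n])
    show "J_ldiv h h' \<in> Jn n" using *(1) in_Jn_iff[OF n, of "J_ldiv h h'"] by simp
    show "fps_nth (J_ldiv h h') (n + 1) = fps_nth (h' - h) (n + 1)" using *(2) n by simp
    show "J_ldiv h h' \<in> H" using h by (intro ldiv_in_H)
  qed
qed

lemma lead_coeffs_diff:
  assumes n: "n \<ge> 1" and "\<alpha> \<in> lead_coeffs H n" "\<beta> \<in> lead_coeffs H n"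
  shows "\<alpha> - \<beta> \<in> lead_coeffs H n"
proof -
  obtain h where h: "h \<in> H" "h \<in> Jn n" "fps_nth h (n + 1) = \<alpha>"
    by (rule lead_coeffsE[OF n assms(2)])
  obtain h' where h': "h' \<in> H" "h' \<in> Jn n" "fps_nth h' (n + 1) = \<beta>"
    by (rule lead_coeffsE[OF n assms(3)])
  have "h - h' \<in> tail (n + 1)"
    using tail_diff[of "h - fps_X" "n + 1" "h' - fps_X"] h(2) h'(2)
      in_Jn_iff[OF n, of h] in_Jn_iff[OF n, of h'] by simp
  then show ?thesis using leading_difference[OF n h'(1) h(1)] h h' by simp
qed

lemma lead_coeffs_zero:
  assumes "n \<ge> 1"
  shows "0 \<in> lead_coeffs H n"
proof -
  have "fps_nth fps_X (n + 1) = (0 :: 'r)" using assms by simp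
  then show ?thesis by (rule lead_coeffsI[OF assms fps_X_in_H fps_X_in_Jn])
qed

lemma lead_coeffs_uminus:
  assumes "n \<ge> 1" "\<alpha> \<in> lead_coeffs H n"
  shows "- \<alpha> \<in> lead_coeffs H n"
  using lead_coeffs_diff[OF assms(1) lead_coeffs_zero[OF assms(1)] assms(2)] by (simp only: diff_0)

lemma lead_coeffs_add:
  assumes "n \<ge> 1" "\<alpha> \<in> lead_coeffs H n" "\<beta> \<in> lead_coeffs H n"
  shows "\<alpha> + \<beta> \<in> lead_coeffs H n"
  using lead_coeffs_diff[OF assms(1,2) lead_coeffs_uminus[OF assms(1,3)]]
  by (simp only: diff_minus_eq_add)

lemma lead_coeffs_bracket:
  assumes n: "n \<ge> 1" and m: "m \<ge> 1" and "\<alpha> \<in> lead_coeffs H n"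
  shows "bracket n m r \<alpha> \<in> lead_coeffs H (m + n)"
proof -
  obtain h where h: "h \<in> H" "h \<in> Jn n" "fps_nth h (n + 1) = \<alpha>"
    by (rule lead_coeffsE[OF n assms(3)])
  define d where "d = fps_const r * fps_X ^ (m + 1)"
  have d: "d \<in> tail (m + 1)" "fps_nth d (m + 1) = r" by (auto simp: d_def tail_def)
  have "h \<in> J" using h H_subset_J by blast
  then have 1: "J_commutator fps_X h = fps_X" by (rule J_commutator_fps_X)
  let ?c = "J_commutator (fps_X + d) h"
  have 2: "?c - fps_X \<in> tail (m + n + 1)" "fps_nth (?c - fps_X) (m + n + 1) = bracket n m r \<alpha>"
    using J_commutator_perturbation[OF fps_X_in_J d(1) _ h(2) n] m
    unfolding 1 bracket_def d(2) h(3) by (auto simp: add_ac)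
  have "fps_X + d \<in> J" using J_add_tail[OF fps_X_in_J d(1)] m by simp
  then have "?c \<in> H" using h(1) by (rule commutator_closed)
  moreover have "?c \<in> Jn (m + n)" using 2(1) in_Jn_iff[of "m + n" ?c] n by simp
  moreover have "fps_nth ?c (m + n + 1) = bracket n m r \<alpha>" using 2(2) n by simp
  ultimately show ?thesis by (rule lead_coeffsI[rotated]) (use n in simp)
qed

lemma of_nat_inverse:
  assumes "k > 0"
  obtains q :: 'r where "of_nat k * q = 1" "\<And>x. q * x = x * q"
proof -
  obtain q :: 'r where q: "of_nat k * q = 1" using ex_of_nat_inverse[OF assms] by blast
  have q': "q * of_nat k = 1" using q by (simp add: mult_of_nat_commute)
  have "q * x = x * q" for x
  proof -
    have "q * x = q * x * (of_nat k * q)" using q by simp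
    also have "\<dots> = q * (x * of_nat k) * q" by (simp add: mult.assoc)
    also have "\<dots> = q * (of_nat k * x) * q" by (simp add: mult_of_nat_commute)
    also have "\<dots> = q * of_nat k * x * q" by (simp add: mult.assoc)
    finally show ?thesis using q' by simp
  qed
  then show thesis using q that by blast
qed

text \<open>For central \<open>r\<close> the bracket is \<open>(m - n) r \<alpha>\<close>, and \<open>m - n\<close> is invertible for \<open>m = k - n > n\<close>.\<close>

lemma lead_coeffs_propagate:
  assumes n: "n \<ge> 1" and "\<alpha> \<in> lead_coeffs H n" "k > 2 * n"
  shows "\<alpha> \<in> lead_coeffs H k"
proof -
  obtain l where l: "k = (n + l) + n" "l > 0"
    using assms(3) by (intro that[of "k - 2 * n"]) auto
  obtain q :: 'r where q: "of_nat l * q = 1" "\<And>x. q * x = x * q" using of_nat_inverse[OF l(2)] by blast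
  have "bracket n (n + l) q \<alpha> = of_nat l * q * \<alpha>"
    using q(2)[of \<alpha>] by (simp add: bracket_def algebra_simps)
  then have "bracket n (n + l) q \<alpha> = \<alpha>" using q(1) by simp
  then show ?thesis using lead_coeffs_bracket[of n "n + l" \<alpha> q] assms l n by simp
qed

lemma sum_of_adjacent_brackets:
  fixes w g :: 'r
  shows "bracket n (m + 1) (of_nat i * w) g + bracket (n + 1) m (- (of_nat j * w)) g =
    (of_nat ((m + 1 + 1) * i) - of_nat ((m + 1) * j)) * (w * g) -
    (of_nat ((n + 1) * i) - of_nat ((n + 1 + 1) * j)) * (g * w)"
proof -
  have gw: "g * (of_nat l * w) = of_nat l * (g * w)" for l
    by (metis mult.assoc mult_of_nat_commute)
  have regroup: "a - b + (- c - - d) = (a - c) - (b - d)" for a b c d :: 'r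
    by simp
  show ?thesis
    by (simp only: bracket_def mult_minus_left mult_minus_right mult.assoc gw of_nat_mult
        left_diff_distrib regroup)
qed

text \<open>Brackets from two adjacent orders into one degree separate left from right multiplication:
  as equations for the scalar multiples of \<open>s\<close> that go into the two brackets, they have
  determinant \<open>n + m + 3\<close>.\<close>

lemma ex_bracket_left_mult:
  "\<exists>r r'. \<forall>g::'r. bracket n (m + 1) r g + bracket (n + 1) m r' g = s * g"
proof -
  obtain q :: 'r where q: "of_nat (n + m + 3) * q = 1"
    by (rule of_nat_inverse[of "n + m + 3"]) auto
  have "(m + 1 + 1) * (n + 2) = (m + 1) * (n + 1) + (n + m + 3)" by simp
  then have 1: "of_nat ((m + 1 + 1) * (n + 2)) - of_nat ((m + 1) * (n + 1)) = (of_nat (n + m + 3) :: 'r)"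
    by (simp only: of_nat_add add_diff_cancel_left')
  have "(n + 1) * (n + 2) = (n + 1 + 1) * (n + 1)" by simp
  then have 2: "of_nat ((n + 1) * (n + 2)) - of_nat ((n + 1 + 1) * (n + 1)) = (0 :: 'r)"
    by (simp only: diff_self)
  have "of_nat (n + m + 3) * (q * s * g) = s * g" for g
    by (simp only: mult.assoc[symmetric] q mult_1_left)
  then have "bracket n (m + 1) (of_nat (n + 2) * (q * s)) g +
      bracket (n + 1) m (- (of_nat (n + 1) * (q * s))) g = s * g" for g
    unfolding sum_of_adjacent_brackets 1 2 by simp
  then show ?thesis by (intro exI allI)
qed

lemma ex_bracket_right_mult:
  "\<exists>r r'. \<forall>g::'r. bracket n (m + 1) r g + bracket (n + 1) m r' g = g * s"
proof -
  obtain q :: 'r where q: "of_nat (n + m + 3) * q = 1" "\<And>x. q * x = x * q"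
    by (rule of_nat_inverse[of "n + m + 3"]) auto
  have 1: "of_nat ((m + 1 + 1) * (m + 1)) - of_nat ((m + 1) * (m + 2)) = (0 :: 'r)"
    by (simp add: mult.commute)
  have "(n + 1 + 1) * (m + 2) = (n + 1) * (m + 1) + (n + m + 3)" by simp
  then have 2: "of_nat ((n + 1) * (m + 1)) - of_nat ((n + 1 + 1) * (m + 2)) = - (of_nat (n + m + 3) :: 'r)"
    by (simp only: of_nat_add diff_add_eq_diff_diff_swap diff_self diff_0 minus_diff_eq) simp
  have "of_nat (n + m + 3) * (g * (q * s)) = g * s" for g
  proof -
    have "g * (q * s) = q * (g * s)" using q(2)[of g] by (simp only: mult.assoc[symmetric])
    then show ?thesis by (simp only: mult.assoc[symmetric] q(1) mult_1_left)
  qed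
  then have "bracket n (m + 1) (of_nat (m + 1) * (q * s)) g +
      bracket (n + 1) m (- (of_nat (m + 2) * (q * s))) g = g * s" for g
    unfolding sum_of_adjacent_brackets 1 2 by (simp only: mult_zero_left mult_minus_left diff_0 minus_minus)
  then show ?thesis by (intro exI allI)
qed

lemma lead_coeffs_mult:
  assumes n: "n \<ge> 1" and \<alpha>: "\<alpha> \<in> lead_coeffs H n" "\<alpha> \<in> lead_coeffs H (n + 1)" and k: "k \<ge> n + 2"
  shows "s * \<alpha> \<in> lead_coeffs H k" and "\<alpha> * s \<in> lead_coeffs H k"
proof -
  obtain m where m: "k = n + m + 1" "m \<ge> 1" using k by (intro that[of "k - n - 1"]) auto
  have "bracket n (m + 1) r \<alpha> \<in> lead_coeffs H k" for r
    using lead_coeffs_bracket[OF n, of "m + 1" \<alpha> r] \<alpha>(1) m by (simp add: add_ac)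
  moreover have "bracket (n + 1) m r \<alpha> \<in> lead_coeffs H k" for r
    using lead_coeffs_bracket[of "n + 1" m \<alpha> r] \<alpha>(2) m by (simp add: add_ac)
  ultimately have "bracket n (m + 1) r \<alpha> + bracket (n + 1) m r' \<alpha> \<in> lead_coeffs H k" for r r'
    using lead_coeffs_add[of k] m by simp
  moreover obtain r r' where "\<forall>g. bracket n (m + 1) r g + bracket (n + 1) m r' g = s * g"
    using ex_bracket_left_mult by blast
  moreover obtain p p' where "\<forall>g. bracket n (m + 1) p g + bracket (n + 1) m p' g = g * s"
    using ex_bracket_right_mult by blast
  ultimately show "s * \<alpha> \<in> lead_coeffs H k" "\<alpha> * s \<in> lead_coeffs H k"
    by metis+
qed

text \<open>Propagation puts \<open>\<alpha>\<close> into the adjacent orders \<open>2 n + 1\<close> and \<open>2 n + 2\<close>, hence \<open>r \<alpha>\<close> into all orders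
  from \<open>2 n + 3\<close> on, hence \<open>r \<alpha> s\<close> into all orders from \<open>2 n + 5\<close> on.\<close>

lemma lead_coeffs_two_sided_mult:
  assumes n: "n \<ge> 1" and \<alpha>: "\<alpha> \<in> lead_coeffs H n" and k: "k \<ge> 2 * n + 5"
  shows "r * \<alpha> * s \<in> lead_coeffs H k"
proof -
  have left: "r * \<alpha> \<in> lead_coeffs H j" if "j \<ge> 2 * n + 3" for j
    by (rule lead_coeffs_mult(1)[of "2 * n + 1"]) (use n \<alpha> that lead_coeffs_propagate[OF n \<alpha>] in auto)
  show ?thesis
    using k by (intro lead_coeffs_mult(2)[of "2 * n + 3" "r * \<alpha>"] left) simp_all
qed

text \<open>The elements with this property form a two-sided ideal, even though the set of leading
  coefficients of a single order is only an additive group.\<close>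

lemma coeff_ideal_eventually_lead:
  assumes "x \<in> coeff_ideal H"
  shows "\<exists>N\<ge>1. \<forall>k\<ge>N. \<forall>r s. r * x * s \<in> lead_coeffs H k"
proof -
  define E where "E = {x. \<exists>N\<ge>1. \<forall>k\<ge>N. \<forall>r s. r * x * s \<in> lead_coeffs H k}"
  have EI: "x \<in> E" if "N \<ge> 1" "\<And>k r s. k \<ge> N \<Longrightarrow> r * x * s \<in> lead_coeffs H k" for x N
    unfolding E_def using that by (intro CollectI exI[of _ N]) simp
  have EE: thesis if "x \<in> E"
    "\<And>N. N \<ge> 1 \<Longrightarrow> (\<And>k r s. k \<ge> N \<Longrightarrow> r * x * s \<in> lead_coeffs H k) \<Longrightarrow> thesis" for x thesis
  proof -
    from that(1) obtain N where "N \<ge> 1 \<and> (\<forall>k\<ge>N. \<forall>r s. r * x * s \<in> lead_coeffs H k)"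
      unfolding E_def mem_Collect_eq by (rule exE)
    then show thesis by (intro that(2)[of N]) simp_all
  qed
  have "0 \<in> E" by (rule EI[of 1]) (simp_all add: lead_coeffs_zero)
  moreover have "x + y \<in> E" if xy: "x \<in> E" "y \<in> E" for x y
  proof -
    obtain M where M: "M \<ge> 1" "\<And>k r s. k \<ge> M \<Longrightarrow> r * x * s \<in> lead_coeffs H k"
      by (rule EE[OF xy(1)]) (rule that)
    obtain N where N: "N \<ge> 1" "\<And>k r s. k \<ge> N \<Longrightarrow> r * y * s \<in> lead_coeffs H k"
      by (rule EE[OF xy(2)]) (rule that)
    have "r * (x + y) * s \<in> lead_coeffs H k" if "k \<ge> max M N" for k r s
    proof -
      have "r * x * s + r * y * s \<in> lead_coeffs H k"
        using that M N by (intro lead_coeffs_add) auto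
      then show ?thesis by (simp add: distrib_left distrib_right)
    qed
    then show ?thesis using M(1) by (intro EI[of "max M N"]) auto
  qed
  moreover have "- x \<in> E" if x: "x \<in> E" for x
  proof -
    obtain N where N: "N \<ge> 1" "\<And>k r s. k \<ge> N \<Longrightarrow> r * x * s \<in> lead_coeffs H k"
      by (rule EE[OF x]) (rule that)
    have "r * (- x) * s \<in> lead_coeffs H k" if "k \<ge> N" for k r s
      using N(2)[OF that, of "- r" s] by simp
    then show ?thesis by (rule EI[OF N(1)])
  qed
  moreover have "r * x \<in> E \<and> x * r \<in> E" if x: "x \<in> E" for x r
  proof -
    obtain N where N: "N \<ge> 1" "\<And>k r s. k \<ge> N \<Longrightarrow> r * x * s \<in> lead_coeffs H k"
      by (rule EE[OF x]) (rule that)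
    have "p * (r * x) * s \<in> lead_coeffs H k" "p * (x * r) * s \<in> lead_coeffs H k" if "k \<ge> N" for k p s
      using N(2)[OF that, of "p * r" s] N(2)[OF that, of p "r * s"] by (simp_all add: mult.assoc)
    then show ?thesis using EI[OF N(1)] by blast
  qed
  ultimately have "two_sided_ideal E"
    by (auto simp: two_sided_ideal_def left_ideal_def right_ideal_def)
  moreover have "(\<Union>n\<in>{1..}. lead_coeffs H n) \<subseteq> E"
  proof safe
    fix n x assume n: "1 \<le> n" and x: "x \<in> lead_coeffs H n"
    show "x \<in> E"
      by (rule EI[of "2 * n + 5"]) (simp_all add: lead_coeffs_two_sided_mult[OF n x])
  qed
  ultimately have "coeff_ideal H \<subseteq> E"
    unfolding coeff_ideal_def by (intro hull_minimal)
  then show ?thesis using assms by (auto simp: E_def)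
qed

lemma lead_coeffs_subset_coeff_ideal: "n \<ge> 1 \<Longrightarrow> lead_coeffs H n \<subseteq> coeff_ideal H"
  unfolding coeff_ideal_def by (rule order_trans[OF _ hull_subset]) auto

end

section \<open>Finite generation and closedness\<close>

lemma left_ideal_hull_finite:
  fixes g :: "nat \<Rightarrow> 'r::ring_1"
  assumes "x \<in> left_ideal hull (g ` {..<k})"
  shows "\<exists>s. x = (\<Sum>j<k. s j * g j)"
proof -
  define S where "S = {x. \<exists>s. x = (\<Sum>j<k. s j * g j)}"
  have SI: "(\<Sum>j<k. s j * g j) \<in> S" for s by (auto simp: S_def)
  have "left_ideal S"
    unfolding left_ideal_def
  proof (intro conjI ballI allI)
    show "0 \<in> S" using SI[of "\<lambda>_. 0"] by simp
  next
    fix x y assume "x \<in> S" "y \<in> S"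
    then obtain s s' where "x = (\<Sum>j<k. s j * g j)" "y = (\<Sum>j<k. s' j * g j)" by (auto simp: S_def)
    then show "x + y \<in> S" using SI[of "\<lambda>j. s j + s' j"] by (simp add: distrib_right sum.distrib)
  next
    fix x assume "x \<in> S"
    then obtain s where "x = (\<Sum>j<k. s j * g j)" by (auto simp: S_def)
    then show "- x \<in> S" using SI[of "\<lambda>j. - s j"] by (simp add: sum_negf)
  next
    fix r x assume "x \<in> S"
    then obtain s where "x = (\<Sum>j<k. s j * g j)" by (auto simp: S_def)
    then show "r * x \<in> S" using SI[of "\<lambda>j. r * s j"] by (simp add: sum_distrib_left mult.assoc)
  qed
  moreover have "g ` {..<k} \<subseteq> S"
  proof safe
    fix i assume i: "i < k"
    have "(\<Sum>j<k. (if j = i then 1 else 0) * g j) = g i" using i by (simp add: mult_delta_left)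
    then show "g i \<in> S" using SI by metis
  qed
  ultimately have "left_ideal hull (g ` {..<k}) \<subseteq> S" by (intro hull_minimal)
  then show ?thesis using assms(1) by (auto simp: S_def)
qed

lemma right_ideal_hull_finite:
  fixes g :: "nat \<Rightarrow> 'r::ring_1"
  assumes "x \<in> right_ideal hull (g ` {..<k})"
  shows "\<exists>s. x = (\<Sum>j<k. g j * s j)"
proof -
  define S where "S = {x. \<exists>s. x = (\<Sum>j<k. g j * s j)}"
  have SI: "(\<Sum>j<k. g j * s j) \<in> S" for s by (auto simp: S_def)
  have "right_ideal S"
    unfolding right_ideal_def
  proof (intro conjI ballI allI)
    show "0 \<in> S" using SI[of "\<lambda>_. 0"] by simp
  next
    fix x y assume "x \<in> S" "y \<in> S"
    then obtain s s' where "x = (\<Sum>j<k. g j * s j)" "y = (\<Sum>j<k. g j * s' j)" by (auto simp: S_def)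
    then show "x + y \<in> S" using SI[of "\<lambda>j. s j + s' j"] by (simp add: distrib_left sum.distrib)
  next
    fix x assume "x \<in> S"
    then obtain s where "x = (\<Sum>j<k. g j * s j)" by (auto simp: S_def)
    then show "- x \<in> S" using SI[of "\<lambda>j. - s j"] by (simp add: sum_negf)
  next
    fix r x assume "x \<in> S"
    then obtain s where "x = (\<Sum>j<k. g j * s j)" by (auto simp: S_def)
    then show "x * r \<in> S" using SI[of "\<lambda>j. s j * r"] by (simp add: sum_distrib_right mult.assoc)
  qed
  moreover have "g ` {..<k} \<subseteq> S"
  proof safe
    fix i assume i: "i < k"
    have "(\<Sum>j<k. g j * (if j = i then 1 else 0)) = g i" using i by (simp add: mult_delta_right)
    then show "g i \<in> S" using SI by metis
  qed
  ultimately have "right_ideal hull (g ` {..<k}) \<subseteq> S" by (intro hull_minimal)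
  then show ?thesis using assms by (auto simp: S_def)
qed

lemma fin_gen_ideal_generators:
  fixes I :: "'r::ring_1 set"
  assumes "fin_gen_left_ideal I \<or> fin_gen_right_ideal I"
  obtains g :: "nat \<Rightarrow> 'r" and k where "\<And>j. j < k \<Longrightarrow> g j \<in> I"
    and "(\<forall>x\<in>I. \<exists>s. x = (\<Sum>j<k. s j * g j)) \<or> (\<forall>x\<in>I. \<exists>s. x = (\<Sum>j<k. g j * s j))"
proof -
  obtain F where F: "finite F" "I = left_ideal hull F \<or> I = right_ideal hull F"
    using assms by (auto simp: fin_gen_left_ideal_def fin_gen_right_ideal_def)
  obtain k and g :: "nat \<Rightarrow> 'r" where g: "F = g ` {..<k}"
    using finite_imp_nat_seg_image_inj_on[OF F(1)] by (auto simp: lessThan_def)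
  have "F \<subseteq> I" using F(2) hull_subset by metis
  then have "g j \<in> I" if "j < k" for j using that g by auto
  moreover have "(\<forall>x\<in>I. \<exists>s. x = (\<Sum>j<k. s j * g j)) \<or> (\<forall>x\<in>I. \<exists>s. x = (\<Sum>j<k. g j * s j))"
    using F(2) left_ideal_hull_finite[of _ g k] right_ideal_hull_finite[of _ g k] unfolding g by blast
  ultimately show thesis by (rule that)
qed

lemma sum_lessThan_double:
  fixes f :: "nat \<Rightarrow> 'a::comm_monoid_add"
  shows "(\<Sum>j<2 * k. f j) = (\<Sum>j<k. f (2 * j) + f (2 * j + 1))"
  by (induction k) (simp_all add: add.assoc)

context commutator_invariant_subloop
begin

text \<open>Finite generation makes the bound on the order uniform: finitely many generators give one
  order from which on \<open>H\<close> has every element of the ideal as a leading coefficient.\<close>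

lemma coeff_ideal_subset_lead_coeffs:
  assumes fin: "fin_gen_left_ideal (coeff_ideal H) \<or> fin_gen_right_ideal (coeff_ideal H)"
  obtains N where "N \<ge> 1" "\<And>n. n \<ge> N \<Longrightarrow> coeff_ideal H \<subseteq> lead_coeffs H n"
proof -
  obtain g :: "nat \<Rightarrow> 'r" and k where g: "\<And>j. j < k \<Longrightarrow> g j \<in> coeff_ideal H"
    "(\<forall>x\<in>coeff_ideal H. \<exists>s. x = (\<Sum>j<k. s j * g j)) \<or> (\<forall>x\<in>coeff_ideal H. \<exists>s. x = (\<Sum>j<k. g j * s j))"
    by (rule fin_gen_ideal_generators[OF fin]) (rule that)
  obtain M where M: "\<And>j n r s. j < k \<Longrightarrow> n \<ge> M j \<Longrightarrow> r * g j * s \<in> lead_coeffs H n"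
    using coeff_ideal_eventually_lead[OF g(1)] by metis
  define N where "N = Max (insert 1 (M ` {..<k}))"
  have N: "N \<ge> 1" "\<And>j. j < k \<Longrightarrow> N \<ge> M j" by (auto simp: N_def)
  have "x \<in> lead_coeffs H n" if n: "n \<ge> N" and x: "x \<in> coeff_ideal H" for x n
  proof -
    have n1: "n \<ge> 1" using n N(1) by simp
    have sum: "(\<Sum>j<l. y j) \<in> lead_coeffs H n" if "\<And>j. j < l \<Longrightarrow> y j \<in> lead_coeffs H n" for y and l :: nat
      using that by (induction l) (auto intro: lead_coeffs_zero[OF n1] lead_coeffs_add[OF n1])
    have "s * g j \<in> lead_coeffs H n" "g j * s \<in> lead_coeffs H n" if "j < k" for s j
      using M[OF that, of n s 1] M[OF that, of n 1 s] N(2)[OF that] n by simp_all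
    then have "(\<Sum>j<k. s j * g j) \<in> lead_coeffs H n" "(\<Sum>j<k. g j * s j) \<in> lead_coeffs H n" for s
      using sum by simp_all
    then show ?thesis using g(2) x by metis
  qed
  then show thesis using that[OF N(1)] by blast
qed

text \<open>A limit \<open>u\<close> of \<open>H\<close> of large order lies in \<open>H\<close>: it is a product of two commutators for each
  generator of the ideal.  The defect of an approximate solution lies in the ideal because \<open>u\<close>
  may be replaced by a nearby element of \<open>H\<close>, which turns the defect into the leading coefficient
  of a quotient of two elements of \<open>H\<close>.\<close>

lemma high_order_limit_in_H:
  assumes fin: "fin_gen_left_ideal (coeff_ideal H) \<or> fin_gen_right_ideal (coeff_ideal H)"
  shows "\<exists>N\<ge>1. \<forall>u\<in>Jn N. (\<forall>p. \<exists>h\<in>H. h - u \<in> tail p) \<longrightarrow> u \<in> H"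
proof -
  obtain g :: "nat \<Rightarrow> 'r" and k where g: "\<And>j. j < k \<Longrightarrow> g j \<in> coeff_ideal H"
    "(\<forall>x\<in>coeff_ideal H. \<exists>s. x = (\<Sum>j<k. s j * g j)) \<or> (\<forall>x\<in>coeff_ideal H. \<exists>s. x = (\<Sum>j<k. g j * s j))"
    by (rule fin_gen_ideal_generators[OF fin]) (rule that)
  obtain N where N: "N \<ge> 1" "\<And>n. n \<ge> N \<Longrightarrow> coeff_ideal H \<subseteq> lead_coeffs H n"
    by (rule coeff_ideal_subset_lead_coeffs[OF fin]) (rule that)
  \<comment> \<open>The factors \<open>2 j\<close> and \<open>2 j + 1\<close> both belong to the generator \<open>g j\<close>, in adjacent orders.\<close>
  define n where "n i = N + i mod 2" for i
  have n: "1 \<le> n i" "n i < N + 2" "N \<le> n i" for i using N(1) by (auto simp: n_def)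
  have "\<exists>h. h \<in> H \<and> h \<in> Jn (n i) \<and> fps_nth h (n i + 1) = g (i div 2)" if "i < 2 * k" for i
  proof -
    have "i div 2 < k" using that by (simp add: less_mult_imp_div_less mult.commute)
    then have "g (i div 2) \<in> lead_coeffs H (n i)" using N(2)[OF n(3)[of i]] g(1)[of "i div 2"] by blast
    then show ?thesis by (rule lead_coeffsE[OF n(1)]) blast
  qed
  then obtain h where h: "\<And>i. i < 2 * k \<Longrightarrow> h i \<in> H \<and> h i \<in> Jn (n i) \<and> fps_nth (h i) (n i + 1) = g (i div 2)"
    by metis
  have brackets: "\<exists>r. x = (\<Sum>i<2 * k. bracket (n i) (M - n i) (r i) (fps_nth (h i) (n i + 1)))"
    if x: "x \<in> coeff_ideal H" and M: "M \<ge> N + 2" for x M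
  proof -
    define m where "m = M - N - 1"
    have m: "M - N = m + 1" "M - (N + 1) = m" using M by (auto simp: m_def)
    have "\<exists>r r'. x = (\<Sum>j<k. bracket N (m + 1) (r j) (g j) + bracket (N + 1) m (r' j) (g j))"
      using g(2)
    proof
      assume "\<forall>x\<in>coeff_ideal H. \<exists>s. x = (\<Sum>j<k. s j * g j)"
      then obtain s where "x = (\<Sum>j<k. s j * g j)" using x by blast
      moreover obtain r r' where "\<And>j. bracket N (m + 1) (r j) (g j) + bracket (N + 1) m (r' j) (g j) = s j * g j"
        using ex_bracket_left_mult[of N m "s _"] by metis
      ultimately have "x = (\<Sum>j<k. bracket N (m + 1) (r j) (g j) + bracket (N + 1) m (r' j) (g j))"
        by (simp only:)
      then show ?thesis by (intro exI)
    next
      assume "\<forall>x\<in>coeff_ideal H. \<exists>s. x = (\<Sum>j<k. g j * s j)"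
      then obtain s where "x = (\<Sum>j<k. g j * s j)" using x by blast
      moreover obtain r r' where "\<And>j. bracket N (m + 1) (r j) (g j) + bracket (N + 1) m (r' j) (g j) = g j * s j"
        using ex_bracket_right_mult[of N m "s _"] by metis
      ultimately have "x = (\<Sum>j<k. bracket N (m + 1) (r j) (g j) + bracket (N + 1) m (r' j) (g j))"
        by (simp only:)
      then show ?thesis by (intro exI)
    qed
    then obtain r r' where rr: "x = (\<Sum>j<k. bracket N (m + 1) (r j) (g j) + bracket (N + 1) m (r' j) (g j))"
      by blast
    define c where "c i = (if even i then r (i div 2) else r' (i div 2))" for i
    have "x = (\<Sum>i<2 * k. bracket (n i) (M - n i) (c i) (g (i div 2)))"
      unfolding sum_lessThan_double by (simp add: rr c_def n_def m del: add_Suc_right One_nat_def)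
    also have "\<dots> = (\<Sum>i<2 * k. bracket (n i) (M - n i) (c i) (fps_nth (h i) (n i + 1)))"
      by (rule sum.cong) (use h in auto)
    finally show ?thesis by blast
  qed
  have "u \<in> H" if u: "u \<in> Jn (N + 2)" and lim: "\<And>p. \<exists>h\<in>H. h - u \<in> tail p" for u
  proof -
    let ?C = "\<lambda>a. iterated_product (\<lambda>i. J_commutator (a i) (h i)) (2 * k)"
    have C: "?C a \<in> H" if "\<And>i. a i \<in> J" for a
      using that h by (intro iterated_product_in_H commutator_closed) auto
    have "\<exists>a. (\<forall>i. a i \<in> J) \<and> ?C a = u"
    proof (rule ex_commutator_product)
      fix a M assume aJ: "\<And>i. a i \<in> J" and M: "N + 2 \<le> M" and ua: "u - ?C a \<in> tail (M + 1)"
      obtain v where v: "v \<in> H" "v - u \<in> tail (M + 2)" using lim by blast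
      have "v - u \<in> tail (M + 1)" "fps_nth (v - u) (M + 1) = 0"
        using v(2) by (simp_all add: tail_def)
      then have "v - ?C a \<in> tail (M + 1)" "fps_nth (v - ?C a) (M + 1) = fps_nth (u - ?C a) (M + 1)"
        using tail_diff_trans[OF _ ua] by simp_all
      then have "fps_nth (u - ?C a) (M + 1) \<in> lead_coeffs H M"
        using leading_difference[of M "?C a" v] C[OF aJ] v(1) M by simp
      then have "fps_nth (u - ?C a) (M + 1) \<in> coeff_ideal H"
        using lead_coeffs_subset_coeff_ideal[of M] M by auto
      then show "\<exists>r. fps_nth (u - ?C a) (M + 1) =
          (\<Sum>i<2 * k. bracket (n i) (M - n i) (r i) (fps_nth (h i) (n i + 1)))"
        using M by (rule brackets)
    qed (use h n u in auto)
    then show ?thesis using C by metis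
  qed
  then show ?thesis by (intro exI[of _ "N + 2"]) simp
qed

text \<open>Dividing \<open>f\<close> by a close enough element of \<open>H\<close> leaves a limit of large order.\<close>

lemma limit_in_H:
  assumes fin: "fin_gen_left_ideal (coeff_ideal H) \<or> fin_gen_right_ideal (coeff_ideal H)"
    and f: "f \<in> J" and lim: "\<And>p. \<exists>h\<in>H. h - f \<in> tail p"
  shows "f \<in> H"
proof -
  obtain N where N: "N \<ge> 1" and closed: "\<forall>u\<in>Jn N. (\<forall>p. \<exists>h\<in>H. h - u \<in> tail p) \<longrightarrow> u \<in> H"
    using high_order_limit_in_H[OF fin] by auto
  obtain h where h: "h \<in> H" "h - f \<in> tail (N + 1)" using lim by blast
  have hJ: "h \<in> J" using h H_subset_J by blast
  have "J_ldiv h f \<in> H"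
  proof (rule closed[rule_format])
    have "J_ldiv h f - J_ldiv h h \<in> tail (N + 1)"
      using h N hJ f tail_diff_swap by (intro J_ldiv_congruence(1)) auto
    then show "J_ldiv h f \<in> Jn N" using in_Jn_iff[OF N, of "J_ldiv h f"] hJ by (simp add: J_ldiv_self)
    fix p
    obtain v where v: "v \<in> H" "v - f \<in> tail (p + 2)" using lim by blast
    have "J_ldiv h v - J_ldiv h f \<in> tail (p + 2)"
      using v hJ f H_subset_J by (intro J_ldiv_congruence(1)) auto
    then show "\<exists>v\<in>H. v - J_ldiv h f \<in> tail p"
      using ldiv_in_H[OF h(1) v(1)] tail_antimono[of _ "p + 2" p] by auto
  qed
  then have "fps_compose h (J_ldiv h f) \<in> H" using h(1) by (intro compose_in_H)
  then show ?thesis using J_ldiv(2)[OF hJ f] by simp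
qed

end

theorem proposition5p3:
  fixes scale :: "'k::field_char_0 \<Rightarrow> 'r::ring_1 \<Rightarrow> 'r"
    and H :: "'r fps set"
  assumes "unital_assoc_algebra scale"
    and "is_subloop H J fps_compose fps_X"
    and "\<forall>a\<in>J. \<forall>h\<in>H. J_commutator a h \<in> H"
    and "fin_gen_left_ideal (coeff_ideal H) \<or> fin_gen_right_ideal (coeff_ideal H)"
  shows "closedin J_topology H"
proof -
  interpret algebra: unital_assoc_algebra scale by (rule assms(1))
  have of_nat: "of_nat k * x = scale (of_nat k) x" for k :: nat and x
    by (induction k) (simp_all add: algebra.scale_left_distrib distrib_right)
  interpret commutator_invariant_subloop H
  proof
    fix k :: nat assume "k > 0"
    then have "of_nat k * scale (inverse (of_nat k)) 1 = (1 :: 'r)"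
      by (simp add: of_nat)
    then show "\<exists>q::'r. of_nat k * q = 1" by blast
  qed (use assms(2,3) in auto)
  \<comment> \<open>The translate \<open>f \<circ> Jn n\<close> consists of series that agree with \<open>f\<close> up to degree \<open>n\<close>, so a point
    of \<open>J - H\<close> without a neighbourhood in \<open>J - H\<close> would be a limit of \<open>H\<close>.\<close>
  have "openin J_topology (J - H)"
    unfolding openin_J_topology
  proof (intro conjI ballI)
    fix f assume f: "f \<in> J - H"
    show "\<exists>n\<ge>1. fps_compose f ` Jn n \<subseteq> J - H"
    proof (rule ccontr)
      assume neg: "\<not> (\<exists>n\<ge>1. fps_compose f ` Jn n \<subseteq> J - H)"
      have "\<exists>h\<in>H. h - f \<in> tail p" for p
      proof -
        obtain w where w: "w \<in> Jn (p + 1)" "fps_compose f w \<notin> J - H" using neg by fastforce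
        have "w \<in> J" using w(1) Jn_subset_J[of "p + 1"] by auto
        then have "fps_compose f w \<in> H" using w(2) f fps_compose_in_J[of f w] by auto
        moreover have d: "w - fps_X \<in> tail (p + 2)" using w(1) in_Jn_iff[of "p + 1" w] by simp
        have "fps_compose f (fps_X + (w - fps_X)) - fps_compose f fps_X - (w - fps_X) \<in> tail (Suc (p + 2))"
          using f d by (intro compose_right_congruence) auto
        then have "fps_compose f w - f \<in> tail p"
          using d by (simp add: compose_fps_X_right tail_def)
        ultimately show ?thesis by blast
      qed
      then have "f \<in> H" using limit_in_H[OF assms(4)] f by blast
      then show False using f by blast
    qed
  qed auto
  then show ?thesis using H_subset_J by (simp add: closedin_def)
qed

end
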